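(* Let $e_1,e_2,e_3$ be the standard basis of $\mathbb{R}^3$, let $\lambda_i=e_i$ for $i=1,2,3$, let $\Lambda=\mathbb{Z}^3$, and let $v=\frac12(e_1+e_2-e_3)$. Consider the $3$-periodic framework with periodicity lattice $\Lambda$, with two vertex orbits $\Lambda$ and $v+\Lambda$, and with eight edge orbits represented by the edges joining $v$ to the eight points $$0,\ e_1,\ e_2,\ e_3,\ e_1+e_2,\ e_2+e_3,\ e_3+e_1,\ e_1+e_2+e_3 .$$ Then this framework is stressed and has a smooth two-dimensional local deformation space. It has expansive capabilities, and its infinitesimal expansive cone has two extremal rays, which correspond to fixing the length of the period $\lambda_1$, respectively of the period $\lambda_2$.
   Context: The vertices in the two orbits are placed at $\sum_k n_k\lambda_k$ and $v+\sum_k n_k\lambda_k$ ($n\in\mathbb{Z}^3$), and the edges are all $\Lambda$-translates of the listed representatives. A periodic deformation keeps the same abstract graph, the same abstract periodicity group $\mathbb{Z}^3$ acting on it, and all edge lengths, but both placement and lattice may vary. Up to translation (keeping the vertex at the origin fixed), a nearby configuration is given by vectors $(\lambda_1',\lambda_2',\lambda_3',v')$ with $\lambda_1',\lambda_2',\lambda_3'$ linearly independent, such that $|v'-\sum_k n_k\lambda_k'|=|v-\sum_k n_k\lambda_k|$ for each of the eight representative edges from $v$ to $\sum_k n_k\lambda_k$. The deformation space is the space of such configurations modulo Euclidean isometries (connected component of the given one); "local" means near the given configuration. The infinitesimal edge constraints, in the unknowns $(\dot v,\dot\lambda_1,\dot\lambda_2,\dot\lambda_3)$, are $\langle \sum_k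 n_k\lambda_k-v,\ \sum_k n_k\dot\lambda_k-\dot v\rangle=0$, one for each of the eight representative edges. The framework is stressed if it has a non-trivial periodic stress, that is, a non-trivial linear dependence among these eight linear forms. A one-parameter deformation is expansive if all distances between pairs of joints (vertices) increase or stay the same whenever the parameter increases. A framework has expansive capabilities if it possesses some non-trivial (not induced by Euclidean isometries) one-parameter expansive deformation. The infinitesimal expansive cone is the convex cone, in the tangent space of the deformation space at the given configuration, of those infinitesimal deformations for which the derivative of the squared distance between any two vertices is $\ge0$. An extremal ray corresponds to fixing the length of $\lambda_i$ if it consists of the infinitesimal deformations in the cone with $\langle\lambda_i,\dot\lambda_i\rangle=0$, i.e. it is given by the one-degree-of-freedom mechanism obtained by imposing that $|\lambda_i|$ stays constant. *)

theory Defs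
  imports "HOL-Analysis.Analysis"
begin

text \<open>
  A configuration is a pair of the period vectors \<open>(\<lambda>\<^sub>1, \<lambda>\<^sub>2, \<lambda>\<^sub>3)\<close> and the vector \<open>v\<close>; translations
  are eliminated by keeping the vertex \<open>Lattice 0\<close> at the origin.
  The vertices of the abstract periodic graph are \<open>Lattice n\<close>, placed at \<open>\<Sum>\<^sub>k n\<^sub>k \<lambda>\<^sub>k\<close>, and
  \<open>Shifted n\<close>, placed at \<open>v + \<Sum>\<^sub>k n\<^sub>k \<lambda>\<^sub>k\<close>. Sets of edges are sets of representatives modulo the
  periodicity group; since the placement is periodic, their lengths determine all edge lengths.
\<close>

type_synonym config = "((real^3)^3) \<times> (real^3)"

datatype vertex = Lattice "int^3" | Shifted "int^3"

type_synonym edge = "vertex \<times> vertex"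

definition lattice_point :: "(real^3)^3 \<Rightarrow> int^3 \<Rightarrow> real^3" where
  "lattice_point L n = (\<Sum>k\<in>UNIV. real_of_int (n $ k) *\<^sub>R (L $ k))"

fun position :: "config \<Rightarrow> vertex \<Rightarrow> real^3" where
  "position c (Lattice n) = lattice_point (fst c) n"
| "position c (Shifted n) = snd c + lattice_point (fst c) n"


subsection \<open>Deformation space\<close>

definition realizations :: "edge set \<Rightarrow> config \<Rightarrow> config set" where
  "realizations E c = {c'.
     inj (\<lambda>k. fst c' $ k) \<and> independent (range (\<lambda>k. fst c' $ k)) \<and>
     (\<forall>(x, y)\<in>E. dist (position c' x) (position c' y) = dist (position c x) (position c y))}"

text \<open>A Euclidean isometry that keeps the vertex at the origin fixed is an orthogonal transformation.\<close>

definition congruence_class :: "config \<Rightarrow> config set" where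
  "congruence_class c = {((\<chi> k. R (fst c $ k)), R (snd c)) |R. orthogonal_transformation R}"

text \<open>The quotient topology on the set of congruence classes of realizations.\<close>

definition realizations_mod_isometries :: "edge set \<Rightarrow> config \<Rightarrow> config set topology" where
  "realizations_mod_isometries E c = topology (\<lambda>U.
     U \<subseteq> congruence_class ` realizations E c \<and>
     openin (top_of_set (realizations E c)) {c' \<in> realizations E c. congruence_class c' \<in> U})"

lemma openin_realizations_mod_isometries:
  "openin (realizations_mod_isometries E c) U \<longleftrightarrow>
     U \<subseteq> congruence_class ` realizations E c \<and>
     openin (top_of_set (realizations E c)) {c' \<in> realizations E c. congruence_class c' \<in> U}"
proof -
  let ?S = "realizations E c"
  have "istopology (\<lambda>U. U \<subseteq> congruence_class ` ?S \<and>
          openin (top_of_set ?S) {c' \<in> ?S. congruence_class c' \<in> U})"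
    unfolding istopology_def
  proof (intro conjI allI impI)
    fix U V
    assume *: "U \<subseteq> congruence_class ` ?S \<and> openin (top_of_set ?S) {c' \<in> ?S. congruence_class c' \<in> U}"
      "V \<subseteq> congruence_class ` ?S \<and> openin (top_of_set ?S) {c' \<in> ?S. congruence_class c' \<in> V}"
    have "{c' \<in> ?S. congruence_class c' \<in> U \<inter> V} =
        {c' \<in> ?S. congruence_class c' \<in> U} \<inter> {c' \<in> ?S. congruence_class c' \<in> V}" by blast
    with * show "openin (top_of_set ?S) {c' \<in> ?S. congruence_class c' \<in> U \<inter> V}" by auto
    from * show "U \<inter> V \<subseteq> congruence_class ` ?S" by blast
  next
    fix K
    assume *: "\<forall>U\<in>K. U \<subseteq> congruence_class ` ?S \<and>
      openin (top_of_set ?S) {c' \<in> ?S. congruence_class c' \<in> U}"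
    have "{c' \<in> ?S. congruence_class c' \<in> \<Union>K} =
        \<Union>((\<lambda>U. {c' \<in> ?S. congruence_class c' \<in> U}) ` K)" by blast
    with * show "openin (top_of_set ?S) {c' \<in> ?S. congruence_class c' \<in> \<Union>K}" by auto
    from * show "\<Union>K \<subseteq> congruence_class ` ?S" by blast
  qed
  then show ?thesis
    unfolding realizations_mod_isometries_def by (simp add: topology_inverse')
qed

definition deformation_space :: "edge set \<Rightarrow> config \<Rightarrow> config set topology" where
  "deformation_space E c = subtopology (realizations_mod_isometries E c)
     (connected_component_of_set (realizations_mod_isometries E c) (congruence_class c))"


subsection \<open>Infinitesimal deformations and stresses\<close>

text \<open>Since \<open>position\<close> is linear in the configuration, velocities of vertices are given by \<open>position\<close> too.\<close>

definition edge_form :: "config \<Rightarrow> edge \<Rightarrow> config \<Rightarrow> real" where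
  "edge_form c e w = (case e of (x, y) \<Rightarrow>
     inner (position c y - position c x) (position w y - position w x))"

definition infinitesimal_deformations :: "edge set \<Rightarrow> config \<Rightarrow> config set" where
  "infinitesimal_deformations E c = {w. \<forall>e\<in>E. edge_form c e w = 0}"

definition stressed :: "edge set \<Rightarrow> config \<Rightarrow> bool" where
  "stressed E c \<longleftrightarrow>
     (\<exists>s :: edge \<Rightarrow> real. (\<exists>e\<in>E. s e \<noteq> 0) \<and> (\<forall>w. (\<Sum>e\<in>E. s e * edge_form c e w) = 0))"

text \<open>Infinitesimal isometries fixing the origin: skew-symmetric matrices applied to all vectors.\<close>

definition trivial_deformations :: "config \<Rightarrow> config set" where
  "trivial_deformations c =
     {((\<chi> k. A *v (fst c $ k)), A *v snd c) |A :: real^3^3. transpose A = - A}"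


subsection \<open>Smooth local charts of the deformation space\<close>

fun Ck_on :: "nat \<Rightarrow> 'a::real_normed_vector set \<Rightarrow> ('a \<Rightarrow> 'b::real_normed_vector) \<Rightarrow> bool" where
  "Ck_on 0 S f \<longleftrightarrow> continuous_on S f"
| "Ck_on (Suc k) S f \<longleftrightarrow> (\<forall>x\<in>S. f differentiable (at x)) \<and>
     (\<forall>u. Ck_on k S (\<lambda>x. frechet_derivative f (at x) u))"

text \<open>Meant for open \<open>S\<close> in finite-dimensional spaces only.\<close>

definition smooth_on :: "'a::real_normed_vector set \<Rightarrow> ('a \<Rightarrow> 'b::real_normed_vector) \<Rightarrow> bool" where
  "smooth_on S f \<longleftrightarrow> (\<forall>k. Ck_on k S f)"

text \<open>
  A smooth chart of the deformation space around the class of \<open>c\<close>, given in the inverse direction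
  by a smooth family \<open>\<phi>\<close> of realizations parametrized by an open set \<open>W\<close>. The last condition says
  that the differential of \<open>\<phi>\<close> induces an isomorphism from the parameter space onto the quotient of
  the infinitesimal deformations by the trivial ones, which is the tangent space of the
  deformation space.
\<close>

definition smooth_chart_at ::
  "edge set \<Rightarrow> config \<Rightarrow> 'p::euclidean_space set \<Rightarrow> ('p \<Rightarrow> config) \<Rightarrow> bool" where
  "smooth_chart_at E c W \<phi> \<longleftrightarrow>
     open W \<and> smooth_on W \<phi> \<and> \<phi> ` W \<subseteq> realizations E c \<and> c \<in> \<phi> ` W \<and>
     (\<exists>V. openin (deformation_space E c) V \<and>
          homeomorphic_map (top_of_set W) (subtopology (deformation_space E c) V)
            (\<lambda>p. congruence_class (\<phi> p))) \<and>
     (\<forall>p\<in>W. range (frechet_derivative \<phi> (at p)) \<subseteq> infinitesimal_deformations E (\<phi> p) \<and>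
        (\<forall>w\<in>infinitesimal_deformations E (\<phi> p).
           \<exists>!u. w - frechet_derivative \<phi> (at p) u \<in> trivial_deformations (\<phi> p)))"


subsection \<open>Expansive deformations\<close>

text \<open>A one-parameter deformation starts from \<open>c\<close> at parameter value \<open>0\<close>; non-triviality is
  required of the part after the start.\<close>

definition expansive_capabilities :: "edge set \<Rightarrow> config \<Rightarrow> bool" where
  "expansive_capabilities E c \<longleftrightarrow> (\<exists>\<epsilon>>0. \<exists>\<gamma> :: real \<Rightarrow> config.
     smooth_on {-\<epsilon><..<\<epsilon>} \<gamma> \<and> \<gamma> 0 = c \<and> \<gamma> ` {-\<epsilon><..<\<epsilon>} \<subseteq> realizations E c \<and>
     (\<forall>x y. mono_on {-\<epsilon><..<\<epsilon>} (\<lambda>t. dist (position (\<gamma> t) x) (position (\<gamma> t) y))) \<and>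
     (\<exists>t\<in>{0<..<\<epsilon>}. \<gamma> t \<notin> congruence_class c))"

text \<open>The infinitesimal expansive cone, as a set of representatives: it contains the subspace of
  trivial deformations, and the actual cone is its image modulo that subspace.\<close>

definition expansive_cone :: "edge set \<Rightarrow> config \<Rightarrow> config set" where
  "expansive_cone E c = {w \<in> infinitesimal_deformations E c. \<forall>x y.
     0 \<le> frechet_derivative (\<lambda>c'. (dist (position c' x) (position c' y))\<^sup>2) (at c) w}"

text \<open>Accordingly, an extremal ray of the cone modulo trivial deformations is represented by its
  preimage, i.e. by a face that is a single half-line modulo the trivial deformations.\<close>

definition extremal_ray :: "edge set \<Rightarrow> config \<Rightarrow> config set \<Rightarrow> bool" where
  "extremal_ray E c F \<longleftrightarrow> F face_of expansive_cone E c \<and>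
     (\<exists>w. w \<notin> trivial_deformations c \<and>
          F = {t *\<^sub>R w + y |t y. 0 \<le> t \<and> y \<in> trivial_deformations c})"

text \<open>The ray consists of the elements of the cone with \<open>\<langle>\<lambda>\<^sub>k, \<lambda>\<^sub>k'\<rangle> = 0\<close>. Keeping \<open>|\<lambda>\<^sub>k|\<close> constant amounts to
  inserting an edge orbit along the \<open>k\<close>-th period, and this must yield a mechanism with one degree
  of freedom.\<close>

definition fixes_period_length :: "edge set \<Rightarrow> config \<Rightarrow> 3 \<Rightarrow> config set \<Rightarrow> bool" where
  "fixes_period_length E c k F \<longleftrightarrow>
     F = {w \<in> expansive_cone E c. inner (fst c $ k) (fst w $ k) = 0} \<and>
     (\<exists>(W :: real set) \<phi>. smooth_chart_at (insert (Lattice 0, Lattice (axis k 1)) E) c W \<phi>)"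


subsection \<open>The framework\<close>

definition c0 :: config where
  "c0 = ((\<chi> k. axis k 1), (1/2) *\<^sub>R (axis 1 1 + axis 2 1 - axis 3 1))"

definition edges0 :: "edge set" where
  "edges0 = (\<lambda>n. (Shifted 0, Lattice n)) `
     {0, axis 1 1, axis 2 1, axis 3 1, axis 1 1 + axis 2 1, axis 2 1 + axis 3 1,
      axis 3 1 + axis 1 1, axis 1 1 + axis 2 1 + axis 3 1}"

end

theory Submission
  imports Defs
begin

text \<open>
  By inclusion-exclusion, the eight edge lengths of a realization say exactly that the periods are
  pairwise orthogonal, that \<open>2 \<langle>v, \<lambda>\<^sub>k\<rangle> = |\<lambda>\<^sub>k|\<^sup>2 - d\<^sub>k\<close> with \<open>d = (0, 0, 2)\<close>, and that \<open>|v|\<^sup>2 = 3/4\<close>; the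
  condition from \<open>\<lambda>\<^sub>1 + \<lambda>\<^sub>2 + \<lambda>\<^sub>3\<close> is redundant, which is the stress. Up to isometry a realization is
  thus determined by its period lengths \<open>a\<close>, which range over the smooth surface
  \<open>a\<^sub>1\<^sup>2 + a\<^sub>2\<^sup>2 + a\<^sub>3\<^sup>2 + 4/a\<^sub>3\<^sup>2 = 7\<close>. In terms of \<open>a\<close>, every squared distance between vertices is a constant plus
  a combination of the \<open>a\<^sub>k\<^sup>2\<close> with coefficients \<open>m\<^sub>k\<^sup>2\<close> or \<open>m\<^sub>k\<^sup>2 \<plusminus> m\<^sub>k \<ge> 0\<close> (\<open>m\<^sub>k\<close> integers), so a deformation is
  expansive iff no period shrinks. At \<open>a = (1, 1, 1)\<close> the tangent plane of the surface is
  \<open>x\<^sub>1 + x\<^sub>2 = 3 x\<^sub>3\<close>, so the expansive cone is the quadrant \<open>x\<^sub>1 \<ge> 0, x\<^sub>2 \<ge> 0\<close>.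
\<close>

subsection \<open>Calculus of smooth functions\<close>

text \<open>Derivatives at a point of the open set \<open>S\<close> depend only on nearby values.
  Both functions vary in the induction, since the next level compares their directional
  derivatives.\<close>

lemma Ck_on_cong:
  assumes "open S" "\<And>x. x \<in> S \<Longrightarrow> f x = g x" "Ck_on k S f"
  shows "Ck_on k S g"
  using assms(2,3)
proof (induction k arbitrary: f g)
  case 0
  then show ?case using continuous_on_cong[of S S f g] by auto
next
  case (Suc k)
  have der: "(g has_derivative frechet_derivative f (at x)) (at x)" if "x \<in> S" for x
  proof (rule has_derivative_transform_within_open[OF _ \<open>open S\<close> that])
    show "(f has_derivative frechet_derivative f (at x)) (at x)"
      using Suc.prems(2) that by (simp add: frechet_derivative_works)
  qed (rule Suc.prems(1))
  have "Ck_on k S (\<lambda>x. frechet_derivative g (at x) u)" for u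
  proof (rule Suc.IH)
    show "frechet_derivative f (at x) u = frechet_derivative g (at x) u" if "x \<in> S" for x
      using frechet_derivative_at[OF der[OF that]] by simp
    show "Ck_on k S (\<lambda>x. frechet_derivative f (at x) u)"
      using Suc.prems(2) by simp
  qed
  with der show ?case
    by (auto simp: differentiable_def)
qed

text \<open>Lets any explicit derivative on \<open>S\<close> stand in for
  \<open>frechet_derivative\<close>, which reduces the closure properties below to differentiation
  rules.\<close>

lemma Ck_on_derivativeI:
  assumes "open S"
    and der: "\<And>x. x \<in> S \<Longrightarrow> (f has_derivative f' x) (at x)"
    and Ck: "\<And>u. Ck_on k S (\<lambda>x. f' x u)"
  shows "Ck_on (Suc k) S f"
proof -
  have "f' x = frechet_derivative f (at x)" if "x \<in> S" for x
    using frechet_derivative_at[OF der[OF that]] .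
  then have "Ck_on k S (\<lambda>x. frechet_derivative f (at x) u)" for u
    using Ck_on_cong[OF \<open>open S\<close> _ Ck[of u]] by simp
  with der show ?thesis
    by (auto simp: differentiable_def)
qed

lemma Ck_on_has_derivative:
  "Ck_on (Suc k) S f \<Longrightarrow> x \<in> S \<Longrightarrow> (f has_derivative frechet_derivative f (at x)) (at x)"
  by (simp add: frechet_derivative_works)

lemma Ck_on_SucD: "Ck_on (Suc k) S f \<Longrightarrow> Ck_on k S f"
proof (induction k arbitrary: f)
  case 0
  then show ?case
    by (simp add: differentiable_imp_continuous_on differentiable_on_def differentiable_at_withinI)
next
  case (Suc k)
  have "\<forall>x\<in>S. f differentiable (at x)"
    and "Ck_on (Suc k) S (\<lambda>x. frechet_derivative f (at x) u)" for u
    using Suc.prems unfolding Ck_on.simps(2)[of "Suc k"] by blast+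
  with Suc.IH show ?case
    by (subst Ck_on.simps(2)) blast
qed

lemma Ck_on_const: "open S \<Longrightarrow> Ck_on k S (\<lambda>x. c)"
proof (induction k arbitrary: c)
  case (Suc k)
  then show ?case
    by (intro Ck_on_derivativeI[where f' = "\<lambda>x u. 0"]) auto
qed simp

lemma Ck_on_linear:
  assumes "open S" "bounded_linear f"
  shows "Ck_on k S f"
proof (cases k)
  case 0
  then show ?thesis
    using assms(2) by (auto intro: linear_continuous_on)
next
  case (Suc m)
  have "Ck_on (Suc m) S f"
    using assms by (intro Ck_on_derivativeI[where f' = "\<lambda>x. f"])
      (auto intro: Ck_on_const bounded_linear_imp_has_derivative)
  with Suc show ?thesis
    by simp
qed

lemma Ck_on_linear_compose:
  assumes "open S" "bounded_linear h"
  shows "Ck_on k S f \<Longrightarrow> Ck_on k S (\<lambda>x. h (f x))"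
proof (induction k arbitrary: f)
  case 0
  then show ?case using assms(2) by (auto intro: bounded_linear.continuous_on)
next
  case (Suc k)
  show ?case
    using Suc bounded_linear.has_derivative[OF assms(2) Ck_on_has_derivative[OF Suc.prems]]
    by (intro Ck_on_derivativeI[OF \<open>open S\<close>]) auto
qed

lemma Ck_on_add:
  assumes "open S"
  shows "Ck_on k S f \<Longrightarrow> Ck_on k S g \<Longrightarrow> Ck_on k S (\<lambda>x. f x + g x)"
proof (induction k arbitrary: f g)
  case 0
  then show ?case by (auto intro: continuous_on_add)
next
  case (Suc k)
  show ?case
    using Suc has_derivative_add[OF Ck_on_has_derivative[OF Suc.prems(1)]
        Ck_on_has_derivative[OF Suc.prems(2)]]
    by (intro Ck_on_derivativeI[OF \<open>open S\<close>]) auto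
qed

text \<open>By the product rule the derivative is a sum of products; \<open>Ck_on_SucD\<close>
  brings the undifferentiated factors down to the order of the induction hypothesis.\<close>

lemma Ck_on_mult:
  fixes f g :: "'a::real_normed_vector \<Rightarrow> real"
  assumes "open S"
  shows "Ck_on k S f \<Longrightarrow> Ck_on k S g \<Longrightarrow> Ck_on k S (\<lambda>x. f x * g x)"
proof (induction k arbitrary: f g)
  case 0
  then show ?case by (auto intro: continuous_on_mult)
next
  case (Suc k)
  note D = Ck_on_has_derivative[OF Suc.prems(1)] Ck_on_has_derivative[OF Suc.prems(2)]
  show ?case
  proof (rule Ck_on_derivativeI[OF \<open>open S\<close>])
    show "((\<lambda>x. f x * g x) has_derivative (\<lambda>u. f x * frechet_derivative g (at x) u +
        frechet_derivative f (at x) u * g x)) (at x)" if "x \<in> S" for x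
      using has_derivative_mult[OF D(1)[OF that] D(2)[OF that]] .
    show "Ck_on k S (\<lambda>x. f x * frechet_derivative g (at x) u +
        frechet_derivative f (at x) u * g x)" for u
      using Suc Ck_on_SucD[OF Suc.prems(1)] Ck_on_SucD[OF Suc.prems(2)]
      by (intro Ck_on_add[OF \<open>open S\<close>] Suc.IH) auto
  qed
qed

text \<open>Bootstrapping: the derivative of \<open>1/f\<close> is a polynomial in
  \<open>1/f\<close> and the derivative of \<open>f\<close>, so order \<open>k\<close> for
  \<open>1/f\<close> itself yields order \<open>k + 1\<close>.\<close>

lemma Ck_on_inverse:
  fixes f :: "'a::real_normed_vector \<Rightarrow> real"
  assumes "open S" "\<And>x. x \<in> S \<Longrightarrow> f x \<noteq> 0"
  shows "Ck_on k S f \<Longrightarrow> Ck_on k S (\<lambda>x. inverse (f x))"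
proof (induction k)
  case 0
  then show ?case using assms(2) by (auto intro: continuous_on_inverse)
next
  case (Suc k)
  note D = Ck_on_has_derivative[OF Suc.prems(1)]
  have IH: "Ck_on k S (\<lambda>x. inverse (f x))"
    using Suc Ck_on_SucD by blast
  show ?case
  proof (rule Ck_on_derivativeI[OF \<open>open S\<close>])
    show "((\<lambda>x. inverse (f x)) has_derivative (\<lambda>u. (- 1) *
        (inverse (f x) * frechet_derivative f (at x) u * inverse (f x)))) (at x)" if "x \<in> S" for x
      by (rule has_derivative_eq_rhs[OF Deriv.has_derivative_inverse[OF assms(2)[OF that] D[OF that]]])
        (rule ext, rule mult_minus1[symmetric])
    show "Ck_on k S (\<lambda>x. (- 1) *
        (inverse (f x) * frechet_derivative f (at x) u * inverse (f x)))" for u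
      using Suc.prems by (intro Ck_on_mult[OF \<open>open S\<close>] Ck_on_const[OF \<open>open S\<close>] IH) simp
  qed
qed

text \<open>The same bootstrapping, with derivative \<open>f' / (2 sqrt f)\<close>; strict
  positivity keeps \<open>sqrt\<close> differentiable.\<close>

lemma Ck_on_sqrt:
  fixes f :: "'a::real_normed_vector \<Rightarrow> real"
  assumes "open S" "\<And>x. x \<in> S \<Longrightarrow> f x > 0"
  shows "Ck_on k S f \<Longrightarrow> Ck_on k S (\<lambda>x. sqrt (f x))"
proof (induction k)
  case 0
  then show ?case by (auto intro: continuous_on_real_sqrt)
next
  case (Suc k)
  note D = Ck_on_has_derivative[OF Suc.prems(1)]
  have IH: "Ck_on k S (\<lambda>x. sqrt (f x))"
    using Suc Ck_on_SucD by blast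
  show ?case
  proof (rule Ck_on_derivativeI[OF \<open>open S\<close>])
    fix x assume x: "x \<in> S"
    have "(sqrt has_derivative (\<lambda>u. u * (inverse (sqrt (f x)) / 2))) (at (f x))"
      using DERIV_real_sqrt[OF assms(2)[OF x]] unfolding has_field_derivative_def
      by (rule has_derivative_eq_rhs) (rule ext, rule mult.commute)
    from has_derivative_compose[OF D[OF x] this]
    show "((\<lambda>x. sqrt (f x)) has_derivative (\<lambda>u. frechet_derivative f (at x) u *
        (inverse (sqrt (f x)) * inverse 2))) (at x)"
      by (simp only: divide_inverse)
  next
    show "Ck_on k S (\<lambda>x. frechet_derivative f (at x) u * (inverse (sqrt (f x)) * inverse 2))" for u
    proof (intro Ck_on_mult[OF \<open>open S\<close>] Ck_on_const[OF \<open>open S\<close>])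
      show "Ck_on k S (\<lambda>x. frechet_derivative f (at x) u)"
        using Suc.prems by simp
      show "Ck_on k S (\<lambda>x. inverse (sqrt (f x)))"
        using assms(2) by (intro Ck_on_inverse[OF \<open>open S\<close> _ IH]) fastforce
    qed
  qed
qed

lemma smooth_on_continuous_on: "smooth_on S f \<Longrightarrow> continuous_on S f"
  unfolding smooth_on_def by (metis Ck_on.simps(1))

lemma smooth_on_has_derivative:
  "smooth_on S f \<Longrightarrow> x \<in> S \<Longrightarrow> (f has_derivative frechet_derivative f (at x)) (at x)"
  unfolding smooth_on_def using Ck_on_has_derivative by blast

lemma smooth_on_const: "open S \<Longrightarrow> smooth_on S (\<lambda>x. c)"
  by (simp add: smooth_on_def Ck_on_const)

lemma smooth_on_linear: "open S \<Longrightarrow> bounded_linear f \<Longrightarrow> smooth_on S f"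
  by (simp add: smooth_on_def Ck_on_linear)

lemma smooth_on_linear_compose:
  "open S \<Longrightarrow> bounded_linear h \<Longrightarrow> smooth_on S f \<Longrightarrow> smooth_on S (\<lambda>x. h (f x))"
  by (simp add: smooth_on_def Ck_on_linear_compose)

lemma smooth_on_add:
  "open S \<Longrightarrow> smooth_on S f \<Longrightarrow> smooth_on S g \<Longrightarrow> smooth_on S (\<lambda>x. f x + g x)"
  by (simp add: smooth_on_def Ck_on_add)

lemma smooth_on_diff:
  assumes "open S" "smooth_on S f" "smooth_on S g"
  shows "smooth_on S (\<lambda>x. f x - g x)"
  using smooth_on_add[OF assms(1,2) smooth_on_linear_compose[OF assms(1) bounded_linear_minus[OF bounded_linear_ident] assms(3)]]
  by simp

lemma smooth_on_mult:
  fixes f g :: "'a::real_normed_vector \<Rightarrow> real"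
  shows "open S \<Longrightarrow> smooth_on S f \<Longrightarrow> smooth_on S g \<Longrightarrow> smooth_on S (\<lambda>x. f x * g x)"
  by (simp add: smooth_on_def Ck_on_mult)

lemma smooth_on_power2:
  fixes f :: "'a::real_normed_vector \<Rightarrow> real"
  shows "open S \<Longrightarrow> smooth_on S f \<Longrightarrow> smooth_on S (\<lambda>x. (f x)\<^sup>2)"
  by (simp add: power2_eq_square smooth_on_mult)

lemma smooth_on_inverse:
  fixes f :: "'a::real_normed_vector \<Rightarrow> real"
  shows "open S \<Longrightarrow> (\<And>x. x \<in> S \<Longrightarrow> f x \<noteq> 0) \<Longrightarrow> smooth_on S f \<Longrightarrow> smooth_on S (\<lambda>x. inverse (f x))"
  by (simp add: smooth_on_def Ck_on_inverse)

lemma smooth_on_sqrt: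
  fixes f :: "'a::real_normed_vector \<Rightarrow> real"
  shows "open S \<Longrightarrow> (\<And>x. x \<in> S \<Longrightarrow> f x > 0) \<Longrightarrow> smooth_on S f \<Longrightarrow> smooth_on S (\<lambda>x. sqrt (f x))"
  by (simp add: smooth_on_def Ck_on_sqrt)

subsection \<open>Deformation spaces of periodic frameworks\<close>

lemma congruence_class_self: "c \<in> congruence_class c"
  unfolding congruence_class_def
  by (auto intro!: exI[of _ "\<lambda>x. x"] orthogonal_transformation_id simp: prod_eq_iff vec_eq_iff)

lemma congruence_class_eqI:
  assumes "orthogonal_transformation R"
    and c': "c' = ((\<chi> k. R (fst c $ k)), R (snd c))"
  shows "congruence_class c' = congruence_class c"
proof -
  obtain R' where R': "orthogonal_transformation R'" "\<And>x. R' (R x) = x"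
    using orthogonal_transformation_inv[OF assms(1)] orthogonal_transformation_inj[OF assms(1)]
    by (metis inv_f_f)
  show ?thesis
  proof (intro equalityI subsetI)
    fix x assume "x \<in> congruence_class c'"
    then obtain Q where "orthogonal_transformation Q" "x = ((\<chi> k. Q (fst c' $ k)), Q (snd c'))"
      unfolding congruence_class_def by auto
    then show "x \<in> congruence_class c"
      unfolding congruence_class_def c' using assms(1)
      by (auto intro!: exI[of _ "Q \<circ> R"] orthogonal_transformation_compose)
  next
    fix x assume "x \<in> congruence_class c"
    then obtain Q where "orthogonal_transformation Q" "x = ((\<chi> k. Q (fst c $ k)), Q (snd c))"
      unfolding congruence_class_def by auto
    then show "x \<in> congruence_class c'"
      unfolding congruence_class_def c' using R'
      by (auto intro!: exI[of _ "Q \<circ> R'"] orthogonal_transformation_compose)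
  qed
qed

lemma congruence_class_norm:
  "c' \<in> congruence_class c \<Longrightarrow> norm (fst c' $ k) = norm (fst c $ k)"
  unfolding congruence_class_def by (auto simp: orthogonal_transformation_norm)

text \<open>Period lengths descend to the quotient by isometries and can serve as coordinates
  there.\<close>

lemma congruence_class_eq_imp_norm_eq:
  "congruence_class c' = congruence_class c \<Longrightarrow> norm (fst c' $ k) = norm (fst c $ k)"
  by (metis congruence_class_norm congruence_class_self)

text \<open>
  The function \<open>g\<close> reads the parameter off a realization; being invariant under congruence,
  it turns open sets of parameters into saturated open sets of realizations.
\<close>

lemma deformation_space_chart:
  fixes g :: "config \<Rightarrow> 'p::euclidean_space"
  assumes W: "open W" "connected W"
    and \<phi>: "continuous_on W \<phi>" "\<phi> ` W \<subseteq> realizations E c" "c \<in> \<phi> ` W"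
    and g: "continuous_on (realizations E c) g"
    and g_\<phi>: "\<And>p. p \<in> W \<Longrightarrow> g (\<phi> p) = p"
    and \<phi>_g: "\<And>c'. c' \<in> realizations E c \<Longrightarrow> g c' \<in> W \<Longrightarrow>
        congruence_class (\<phi> (g c')) = congruence_class c'"
    and g_cong: "\<And>c' c''. congruence_class c' = congruence_class c'' \<Longrightarrow> g c' = g c''"
  shows "\<exists>V. openin (deformation_space E c) V \<and>
    homeomorphic_map (top_of_set W) (subtopology (deformation_space E c) V)
      (\<lambda>p. congruence_class (\<phi> p))"
proof -
  let ?S = "realizations E c" and ?X = "realizations_mod_isometries E c"
  let ?f = "\<lambda>p. congruence_class (\<phi> p)"
  let ?C = "connected_component_of_set ?X (congruence_class c)"
  \<comment> \<open>The realizations congruent to some \<open>\<phi> p\<close> with \<open>p\<close>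
    in \<open>U\<close> are exactly those with \<open>g c'\<close> in \<open>U\<close>, so
    continuity of \<open>g\<close> makes the class map open.\<close>
  have open_image: "openin ?X (?f ` U)" if "open U" "U \<subseteq> W" for U
  proof -
    have "{c' \<in> ?S. congruence_class c' \<in> ?f ` U} = {c' \<in> ?S. g c' \<in> U}"
    proof (intro Collect_cong conj_cong refl iffI)
      fix c' assume c': "c' \<in> ?S"
      show "g c' \<in> U" if *: "congruence_class c' \<in> ?f ` U"
      proof -
        obtain p where "p \<in> U" "congruence_class c' = congruence_class (\<phi> p)"
          using * by blast
        with g_cong g_\<phi> \<open>U \<subseteq> W\<close> show ?thesis
          by (metis subsetD)
      qed
      show "congruence_class c' \<in> ?f ` U" if "g c' \<in> U"
        using that \<phi>_g[OF c'] \<open>U \<subseteq> W\<close> by (metis image_eqI subsetD)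
    qed
    moreover have "openin (top_of_set ?S) {c' \<in> ?S. g c' \<in> U}"
      using continuous_openin_preimage_gen[OF g \<open>open U\<close>]
      by (simp add: vimage_def Int_def)
    ultimately show ?thesis
      unfolding openin_realizations_mod_isometries using \<phi>(2) \<open>U \<subseteq> W\<close> by fastforce
  qed
  have cont: "continuous_map (top_of_set W) ?X ?f"
    unfolding continuous_map
  proof (intro conjI allI impI)
    have "congruence_class ` ?S \<subseteq> topspace ?X"
    proof (rule openin_subset)
      have "{c' \<in> ?S. congruence_class c' \<in> congruence_class ` ?S} = ?S" by auto
      then show "openin ?X (congruence_class ` ?S)"
        by (simp add: openin_realizations_mod_isometries)
    qed
    then show "?f ` topspace (top_of_set W) \<subseteq> topspace ?X"
      using \<phi>(2) by auto
    fix U assume "openin ?X U"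
    then obtain O' where O': "open O'" "{c' \<in> ?S. congruence_class c' \<in> U} = ?S \<inter> O'"
      unfolding openin_realizations_mod_isometries openin_open by blast
    have "{x \<in> topspace (top_of_set W). ?f x \<in> U} = W \<inter> \<phi> -` O'"
      using O'(2) \<phi>(2) by fastforce
    then show "openin (top_of_set W) {x \<in> topspace (top_of_set W). ?f x \<in> U}"
      using continuous_openin_preimage_gen[OF \<phi>(1) O'(1)] by simp
  qed
  have "connectedin ?X (?f ` W)"
    using connectedin_continuous_map_image[OF cont, of W] W(2)
    by (simp add: connectedin_subtopology)
  moreover have "congruence_class c \<in> ?f ` W"
    using \<phi>(3) by auto
  \<comment> \<open>Connectedness of \<open>W\<close> keeps the chart inside the component of the
    given class.\<close>
  ultimately have sub: "?f ` W \<subseteq> ?C"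
    by (simp add: connected_component_of_maximal)
  have open_W: "openin ?X (?f ` W)"
    using open_image[OF W(1)] by simp
  then have open_V: "openin (deformation_space E c) (?f ` W)"
    using sub unfolding deformation_space_def openin_subtopology by blast
  have sub_eq: "subtopology (deformation_space E c) (?f ` W) = subtopology ?X (?f ` W)"
    using sub unfolding deformation_space_def by (simp add: subtopology_subtopology Int_absorb1)
  have "homeomorphic_map (top_of_set W) (subtopology ?X (?f ` W)) ?f"
  proof (rule bijective_open_imp_homeomorphic_map)
    show "continuous_map (top_of_set W) (subtopology ?X (?f ` W)) ?f"
      using cont by (simp add: continuous_map_in_subtopology)
    show "open_map (top_of_set W) (subtopology ?X (?f ` W)) ?f"
      unfolding open_map_def
    proof (intro allI impI)
      fix U assume "openin (top_of_set W) U"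
      then have "open U" "U \<subseteq> W"
        using W(1) by (auto simp: openin_open_eq)
      then show "openin (subtopology ?X (?f ` W)) (?f ` U)"
        using open_image[of U] unfolding openin_subtopology by blast
    qed
    show "?f ` topspace (top_of_set W) = topspace (subtopology ?X (?f ` W))"
      using openin_subset[OF open_W] by auto
    have "inj_on ?f W"
      by (rule inj_onI) (metis g_cong g_\<phi>)
    then show "inj_on ?f (topspace (top_of_set W))"
      by simp
  qed
  then show ?thesis
    by (intro exI[of _ "?f ` W"] conjI open_V) (simp only: sub_eq)
qed

section \<open>Linear placements, edge forms and infinitesimal motions\<close>

lemma lattice_point_0 [simp]: "lattice_point L 0 = 0"
  and lattice_point_axis [simp]: "lattice_point L (axis k 1) = L $ k"
  and lattice_point_add [simp]: "lattice_point L (m + n) = lattice_point L m + lattice_point L n"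
  by (simp_all add: lattice_point_def axis_def if_distrib[of real_of_int] if_distrib[of "\<lambda>x. x *\<^sub>R _"]
      scaleR_add_left sum.distrib cong: if_cong)

lemma bounded_linear_position: "bounded_linear (\<lambda>c. position c x)"
proof -
  have "bounded_linear (\<lambda>c::config. lattice_point (fst c) n)" for n
    unfolding lattice_point_def
    by (intro bounded_linear_sum bounded_linear_scaleR_right[THEN bounded_linear_compose]
        bounded_linear_compose[OF bounded_linear_vec_nth] bounded_linear_fst)
  then show ?thesis
    by (cases x) (auto intro: bounded_linear_add bounded_linear_snd)
qed

text \<open>Placements are linear in the configuration, so the edge form is half the differential of
  the squared distance. This links the linear constraints to actual motions.\<close>

lemma has_derivative_dist_position:
  assumes "(\<phi> has_derivative \<phi>') (at p)"
  shows "((\<lambda>p. (dist (position (\<phi> p) x) (position (\<phi> p) y))\<^sup>2) has_derivative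
    (\<lambda>u. 2 * edge_form (\<phi> p) (x, y) (\<phi>' u))) (at p)"
proof -
  have D: "((\<lambda>p. position (\<phi> p) z) has_derivative (\<lambda>u. position (\<phi>' u) z)) (at p)" for z
    using bounded_linear.has_derivative[OF bounded_linear_position assms] .
  have eq: "(dist (position c x) (position c y))\<^sup>2 =
      (position c y - position c x) \<bullet> (position c y - position c x)" for c
    by (subst dist_commute) (simp only: dist_norm power2_norm_eq_inner)
  show ?thesis
    unfolding eq
    by (rule has_derivative_eq_rhs[OF has_derivative_inner[OF has_derivative_diff[OF D D]
          has_derivative_diff[OF D D]]])
      (simp add: fun_eq_iff edge_form_def inner_commute)
qed

lemma subspace_infinitesimal_deformations: "subspace (infinitesimal_deformations E c)"
proof -
  have "linear (edge_form c e)" for e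
    unfolding edge_form_def case_prod_unfold
    by (intro bounded_linear.linear bounded_linear_inner_right_comp bounded_linear_sub
        bounded_linear_position)
  then show ?thesis
    unfolding subspace_def infinitesimal_deformations_def
    by (simp add: linear_0 linear_add linear_scale)
qed

text \<open>By linearity of the placement all vertices move by the same skew matrix, and a skew
  matrix takes every vector to an orthogonal one.\<close>

lemma trivial_deformations_subset: "trivial_deformations c \<subseteq> infinitesimal_deformations E c"
proof
  fix w assume "w \<in> trivial_deformations c"
  then obtain A :: "real^3^3" where A: "transpose A = - A"
    and w: "w = ((\<chi> k. A *v (fst c $ k)), A *v snd c)"
    by (auto simp: trivial_deformations_def)
  have pos: "position w x = A *v position c x" for x
    by (cases x) (simp_all add: w lattice_point_def matrix_vector_right_distrib
        linear_sum[OF matrix_vector_mul_linear] matrix_vector_mult_scaleR)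
  have "d \<bullet> (A *v d) = 0" for d
  proof -
    have "d \<bullet> (A *v d) = (transpose A *v d) \<bullet> d"
      by (simp add: dot_lmul_matrix[symmetric])
    also have "\<dots> = - (d \<bullet> (A *v d))"
    proof -
      have "(- A) *v d = - (A *v d)"
        by (simp add: vec_eq_iff matrix_vector_mult_def sum_negf)
      then show ?thesis
        unfolding A by (simp add: inner_commute)
    qed
    finally show ?thesis
      by simp
  qed
  then show "w \<in> infinitesimal_deformations E c"
    by (simp add: infinitesimal_deformations_def edge_form_def pos case_prod_unfold
        matrix_vector_mult_diff_distrib[symmetric])
qed

text \<open>Edge lengths are constant on the open set \<open>W\<close>, so the differentials of
  their squares vanish along \<open>\<phi>\<close>.\<close>

lemma frechet_derivative_infinitesimal_deformations:
  assumes "open W" "p \<in> W" "\<phi> ` W \<subseteq> realizations E c" "\<phi> differentiable (at p)"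
  shows "range (frechet_derivative \<phi> (at p)) \<subseteq> infinitesimal_deformations E (\<phi> p)"
proof -
  have "edge_form (\<phi> p) (x, y) (frechet_derivative \<phi> (at p) u) = 0" if "(x, y) \<in> E" for x y u
  proof -
    let ?d = "\<lambda>p. (dist (position (\<phi> p) x) (position (\<phi> p) y))\<^sup>2"
    have "(?d has_derivative (\<lambda>u. 2 * edge_form (\<phi> p) (x, y) (frechet_derivative \<phi> (at p) u))) (at p)"
      using has_derivative_dist_position assms(4) frechet_derivative_works by blast
    moreover have "(?d has_derivative (\<lambda>u. 0)) (at p)"
    proof (rule has_derivative_transform_within_open[OF has_derivative_const \<open>open W\<close> \<open>p \<in> W\<close>])
      show "(dist (position c x) (position c y))\<^sup>2 = ?d q" if "q \<in> W" for q
        using assms(3) that \<open>(x, y) \<in> E\<close> unfolding realizations_def by fastforce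
    qed
    ultimately have "(\<lambda>u. 2 * edge_form (\<phi> p) (x, y) (frechet_derivative \<phi> (at p) u)) = (\<lambda>u. 0)"
      by (rule has_derivative_unique)
    then show ?thesis
      by (simp add: fun_eq_iff)
  qed
  then show ?thesis
    by (auto simp: infinitesimal_deformations_def)
qed

subsection \<open>Edge constraints\<close>

text \<open>The eight forms are the values of a quadratic polynomial at the corners of a cube. The
  conditions say that its value and its first and mixed second differences at the corner 0 vanish,
  which settles all eight corners.\<close>

lemma infinitesimal_deformations_edges0_iff:
  "w \<in> infinitesimal_deformations edges0 c \<longleftrightarrow>
     snd c \<bullet> snd w = 0 \<and>
     (\<forall>i. snd c \<bullet> fst w $ i + fst c $ i \<bullet> snd w = fst c $ i \<bullet> fst w $ i) \<and>
     (\<forall>i j. i \<noteq> j \<longrightarrow> fst c $ i \<bullet> fst w $ j + fst c $ j \<bullet> fst w $ i = 0)"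
proof -
  obtain L v M u where c: "c = (L, v)" and w: "w = (M, u)"
    by (metis prod.exhaust)
  have "w \<in> infinitesimal_deformations edges0 c \<longleftrightarrow>
      (- v) \<bullet> (- u) = 0 \<and>
      (L $ 1 - v) \<bullet> (M $ 1 - u) = 0 \<and> (L $ 2 - v) \<bullet> (M $ 2 - u) = 0 \<and> (L $ 3 - v) \<bullet> (M $ 3 - u) = 0 \<and>
      (L $ 1 + L $ 2 - v) \<bullet> (M $ 1 + M $ 2 - u) = 0 \<and>
      (L $ 2 + L $ 3 - v) \<bullet> (M $ 2 + M $ 3 - u) = 0 \<and>
      (L $ 3 + L $ 1 - v) \<bullet> (M $ 3 + M $ 1 - u) = 0 \<and>
      (L $ 1 + L $ 2 + L $ 3 - v) \<bullet> (M $ 1 + M $ 2 + M $ 3 - u) = 0"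
    by (simp add: infinitesimal_deformations_def edges0_def edge_form_def c w)
  also have "\<dots> \<longleftrightarrow> v \<bullet> u = 0 \<and> (\<forall>i. v \<bullet> M $ i + L $ i \<bullet> u = L $ i \<bullet> M $ i) \<and>
      (\<forall>i j. i \<noteq> j \<longrightarrow> L $ i \<bullet> M $ j + L $ j \<bullet> M $ i = 0)"
    unfolding forall_3 by (simp add: inner_simps) argo
  finally show ?thesis
    by (simp add: c w)
qed

text \<open>The same differences for squared lengths, which are \<open>3/4\<close> at corners
  without the third period and \<open>11/4\<close> at corners with it. The jump by 2 appears at
  \<open>i = 3\<close>; mixed second differences of the prescribed values are 0.\<close>

lemma realizations_edges0_iff:
  "c \<in> realizations edges0 c0 \<longleftrightarrow>
     inj (\<lambda>k. fst c $ k) \<and> independent (range (\<lambda>k. fst c $ k)) \<and>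
     snd c \<bullet> snd c = 3/4 \<and>
     (\<forall>i. 2 * (snd c \<bullet> fst c $ i) = fst c $ i \<bullet> fst c $ i - (if i = 3 then 2 else 0)) \<and>
     (\<forall>i j. i \<noteq> j \<longrightarrow> fst c $ i \<bullet> fst c $ j = 0)"
proof -
  obtain L v where c: "c = (L, v)"
    by (metis prod.exhaust)
  let ?d = "\<lambda>m. (v - m) \<bullet> (v - m)"
  have "(\<forall>(x, y)\<in>edges0. dist (position c x) (position c y) = dist (position c0 x) (position c0 y)) \<longleftrightarrow>
      ?d 0 = 3/4 \<and> ?d (L $ 1) = 3/4 \<and> ?d (L $ 2) = 3/4 \<and> ?d (L $ 3) = 11/4 \<and>
      ?d (L $ 1 + L $ 2) = 3/4 \<and> ?d (L $ 2 + L $ 3) = 11/4 \<and> ?d (L $ 3 + L $ 1) = 11/4 \<and>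
      ?d (L $ 1 + L $ 2 + L $ 3) = 11/4"
    by (simp add: edges0_def c dist_norm norm_eq)
      (simp add: c0_def inner_simps inner_axis_axis)
  also have "\<dots> \<longleftrightarrow> v \<bullet> v = 3/4 \<and>
      (\<forall>i. 2 * (v \<bullet> L $ i) = L $ i \<bullet> L $ i - (if i = 3 then 2 else 0)) \<and>
      (\<forall>i j. i \<noteq> j \<longrightarrow> L $ i \<bullet> L $ j = 0)"
    unfolding forall_3 by (simp add: inner_simps inner_commute) argo
  finally show ?thesis
    by (simp add: realizations_def c)
qed

section \<open>Distances between arbitrary vertices\<close>

text \<open>One formula for all four kinds of pairs, with \<open>s\<close> the difference of the
  orbit labels. As \<open>s\<close> and \<open>d\<close> do not depend on the configuration, it
  applies to velocities as well.\<close>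

lemma position_diff_cases:
  obtains s :: int and d :: "3 \<Rightarrow> int" where "\<bar>s\<bar> \<le> 1"
    "\<And>c. position c y - position c x =
      of_int s *\<^sub>R snd c + (\<Sum>k\<in>UNIV. of_int (d k) *\<^sub>R fst c $ k)"
proof (cases x; cases y)
  fix m n assume "x = Lattice m" "y = Lattice n"
  then show thesis
    by (intro that[of 0 "\<lambda>k. n $ k - m $ k"])
      (simp_all add: lattice_point_def scaleR_diff_left sum_subtractf)
next
  fix m n assume "x = Lattice m" "y = Shifted n"
  then show thesis
    by (intro that[of 1 "\<lambda>k. n $ k - m $ k"])
      (simp_all add: lattice_point_def scaleR_diff_left sum_subtractf)
next
  fix m n assume "x = Shifted m" "y = Lattice n"
  then show thesis
    by (intro that[of "- 1" "\<lambda>k. n $ k - m $ k"])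
      (simp_all add: lattice_point_def scaleR_diff_left sum_subtractf)
next
  fix m n assume "x = Shifted m" "y = Shifted n"
  then show thesis
    by (intro that[of 0 "\<lambda>k. n $ k - m $ k"])
      (simp_all add: lattice_point_def scaleR_diff_left sum_subtractf)
qed

text \<open>Orthogonality removes the mixed terms, and the constraints express inner products with
  \<open>v\<close> by squared period lengths, leaving \<open>q k = d k * (s + d k)\<close>. The same
  coefficients govern finite and infinitesimal deformations.\<close>

lemma distance_coefficients:
  obtains q :: "3 \<Rightarrow> real" and K :: real where "\<And>k. 0 \<le> q k"
    "\<And>c w. w \<in> infinitesimal_deformations edges0 c \<Longrightarrow>
      edge_form c (x, y) w = (\<Sum>k\<in>UNIV. q k * (fst c $ k \<bullet> fst w $ k))"
    "\<And>c. c \<in> realizations edges0 c0 \<Longrightarrow>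
      (dist (position c x) (position c y))\<^sup>2 = K + (\<Sum>k\<in>UNIV. q k * (norm (fst c $ k))\<^sup>2)"
proof -
  obtain s :: int and d :: "3 \<Rightarrow> int" where s: "\<bar>s\<bar> \<le> 1" and
    pos: "\<And>c. position c y - position c x =
      of_int s *\<^sub>R snd c + (\<Sum>k\<in>UNIV. of_int (d k) *\<^sub>R fst c $ k)"
    by (rule position_diff_cases) (rule that)
  define \<sigma> where "\<sigma> = real_of_int s"
  define \<delta> where "\<delta> = (\<lambda>k. real_of_int (d k))"
  define q where "q = (\<lambda>k. \<sigma> * \<delta> k + \<delta> k * \<delta> k)"
  \<comment> \<open>The terms are grouped into the combinations that the edge constraints
    evaluate.\<close>
  have form: "edge_form c (x, y) w = \<sigma>\<^sup>2 * (snd c \<bullet> snd w) +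
      (\<Sum>k\<in>UNIV. \<sigma> * \<delta> k * (snd c \<bullet> fst w $ k + fst c $ k \<bullet> snd w) + \<delta> k * \<delta> k * (fst c $ k \<bullet> fst w $ k)) +
      \<delta> 1 * \<delta> 2 * (fst c $ 1 \<bullet> fst w $ 2 + fst c $ 2 \<bullet> fst w $ 1) +
      \<delta> 1 * \<delta> 3 * (fst c $ 1 \<bullet> fst w $ 3 + fst c $ 3 \<bullet> fst w $ 1) +
      \<delta> 2 * \<delta> 3 * (fst c $ 2 \<bullet> fst w $ 3 + fst c $ 3 \<bullet> fst w $ 2)" for c w
    unfolding edge_form_def prod.case pos \<sigma>_def \<delta>_def sum_3
    by (simp add: inner_simps power2_eq_square algebra_simps)
  show thesis
  proof
    show "0 \<le> q k" for k
    proof -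
      \<comment> \<open>For a nonzero integer \<open>d k\<close>, adding \<open>s\<close> cannot
        reverse the sign.\<close>
      have "0 \<le> d k * (s + d k)"
        using s by (cases "d k" "0::int" rule: linorder_cases)
          (auto intro: mult_nonneg_nonneg mult_nonpos_nonpos)
      then have "0 \<le> real_of_int (d k * (s + d k))"
        by (simp only: of_int_0_le_iff)
      then show ?thesis
        by (simp add: q_def \<sigma>_def \<delta>_def algebra_simps)
    qed
    show "edge_form c (x, y) w = (\<Sum>k\<in>UNIV. q k * (fst c $ k \<bullet> fst w $ k))"
      if "w \<in> infinitesimal_deformations edges0 c" for c w
      using that unfolding form infinitesimal_deformations_edges0_iff
      by (simp add: q_def distrib_right)
    show "(dist (position c x) (position c y))\<^sup>2 =
        (\<sigma>\<^sup>2 * (3/4) - 2 * \<sigma> * \<delta> 3) + (\<Sum>k\<in>UNIV. q k * (norm (fst c $ k))\<^sup>2)"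
      if "c \<in> realizations edges0 c0" for c
    proof -
      \<comment> \<open>A squared distance is the edge form of the configuration with itself, so
        \<open>form\<close> applies again. The constant comes from \<open>|v|^2 = 3/4\<close> and
        the jump by 2 in direction 3.\<close>
      have "(dist (position c x) (position c y))\<^sup>2 = edge_form c (x, y) c"
        by (subst dist_commute) (simp add: dist_norm power2_norm_eq_inner edge_form_def)
      moreover have "snd c \<bullet> fst c $ k + fst c $ k \<bullet> snd c = fst c $ k \<bullet> fst c $ k - (if k = 3 then 2 else 0)" for k
        using that by (simp add: realizations_edges0_iff inner_commute)
      moreover have "snd c \<bullet> snd c = 3/4" "fst c $ 1 \<bullet> fst c $ 2 = 0" "fst c $ 1 \<bullet> fst c $ 3 = 0"
          "fst c $ 2 \<bullet> fst c $ 3 = 0"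
        using that by (simp_all add: realizations_edges0_iff)
      ultimately show ?thesis
        unfolding form by (simp add: inner_commute[of "fst c $ 2" "fst c $ 1"]
          inner_commute[of "fst c $ 3" "fst c $ 1"] inner_commute[of "fst c $ 3" "fst c $ 2"]
          sum_3 q_def power2_norm_eq_inner algebra_simps)
    qed
  qed
qed

text \<open>The stress alternates in sign: a third difference of a quadratic function vanishes.\<close>

lemma stressed_edges0: "stressed edges0 c0"
proof -
  \<comment> \<open>The sign is the parity of the corner. The value 0 at \<open>Shifted\<close> is a
    default: all representative edges end at a \<open>Lattice\<close> vertex.\<close>
  define s :: "edge \<Rightarrow> real" where
    "s e = (case snd e of Lattice n \<Rightarrow> if even (n $ 1 + n $ 2 + n $ 3) then 1 else - 1 | Shifted n \<Rightarrow> 0)" for e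
  have "(\<Sum>e\<in>edges0. s e * edge_form c0 e w) = 0" for w
  proof -
    obtain L v M u where c: "c0 = (L, v)" and w: "w = (M, u)"
      by (metis prod.exhaust)
    have inj: "inj_on (\<lambda>n. (Shifted 0, Lattice n)) A" for A
      by (simp add: inj_on_def)
    have s: "s (x, Lattice n) = (if even (n $ 1 + n $ 2 + n $ 3) then 1 else - 1)" for x n
      by (simp add: s_def)
    show ?thesis
      unfolding edges0_def sum.reindex[OF inj] comp_def s
      by (simp add: vec_eq_iff forall_3 axis_def)
        (simp add: edge_form_def c w axis_def[symmetric] inner_simps)
  qed
  moreover have "(Shifted 0, Lattice 0) \<in> edges0" "s (Shifted 0, Lattice 0) \<noteq> 0"
    by (auto simp: edges0_def s_def)
  ultimately show ?thesis
    unfolding stressed_def by blast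
qed

subsection \<open>Normal form of the realizations\<close>

text \<open>The position of \<open>v\<close> is forced by \<open>2 \<langle>v, \<lambda>\<^sub>k\<rangle> = |\<lambda>\<^sub>k|\<^sup>2 - d\<^sub>k\<close> with \<open>d = (0, 0, 2)\<close>.\<close>

definition diag_config :: "real^3 \<Rightarrow> config" where
  "diag_config a = ((\<chi> k. axis k (a $ k)), (1/2) *\<^sub>R a - axis 3 (1 / a $ 3))"

text \<open>The equation is \<open>4 |v|^2 = 3\<close> for \<open>diag_config a\<close>; the cross
  term of the square of \<open>a $ 3 / 2 - 1 / a $ 3\<close> contributes the -4 that turns 3 into
  7.\<close>

definition period_lengths :: "(real^3) set" where
  "period_lengths = {a. (\<forall>k. 0 < a $ k) \<and>
     (a $ 1)\<^sup>2 + (a $ 2)\<^sup>2 + (a $ 3)\<^sup>2 + 4 / (a $ 3)\<^sup>2 = 7}"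

lemma period_lengths_pos: "a \<in> period_lengths \<Longrightarrow> 0 < a $ k"
  by (simp add: period_lengths_def)

lemma c0_eq_diag_config: "c0 = diag_config 1"
  by (simp add: c0_def diag_config_def vec_eq_iff forall_3 axis_def)

lemma one_in_period_lengths: "1 \<in> period_lengths"
  by (simp add: period_lengths_def)

lemma diag_config_inner:
  assumes "a \<in> period_lengths"
  shows "2 * (snd (diag_config a) $ k * a $ k) = a $ k * a $ k - (if k = 3 then 2 else 0)"
    and "snd (diag_config a) \<bullet> snd (diag_config a) = 3/4"
proof -
  have pos: "0 < a $ 3" and eq: "(a $ 1)\<^sup>2 + (a $ 2)\<^sup>2 + (a $ 3)\<^sup>2 + 4 / (a $ 3)\<^sup>2 = 7"
    using assms by (auto simp: period_lengths_def)
  have "\<forall>k. 2 * (snd (diag_config a) $ k * a $ k) = a $ k * a $ k - (if k = 3 then 2 else 0)"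
    unfolding forall_3 using pos by (simp add: diag_config_def axis_def field_simps)
  then show "2 * (snd (diag_config a) $ k * a $ k) = a $ k * a $ k - (if k = 3 then 2 else 0)"
    by blast
  have "(a $ 3 / 2 - 1 / a $ 3)\<^sup>2 = (a $ 3)\<^sup>2 / 4 - 1 + 1 / (a $ 3)\<^sup>2"
    using pos by (simp add: field_simps power2_eq_square)
  with eq show "snd (diag_config a) \<bullet> snd (diag_config a) = 3/4"
    by (simp add: diag_config_def inner_vec_def sum_3 axis_def power2_eq_square[symmetric] power_divide)
qed

lemma diag_config_realization:
  assumes "a \<in> period_lengths"
  shows "diag_config a \<in> realizations edges0 c0"
proof -
  have pos: "a $ k \<noteq> 0" for k
    using period_lengths_pos[OF assms, of k] by simp
  have orth: "axis i (a $ i) \<bullet> axis j (a $ j) = 0" if "i \<noteq> j" for i j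
    using that by (simp add: inner_axis_axis)
  have nz: "axis k (a $ k) \<noteq> 0" for k
    using pos[of k] by (simp add: axis_eq_0_iff)
  have "inj (\<lambda>k. axis k (a $ k))"
    by (rule injI) (metis orth nz inner_eq_zero_iff)
  moreover have "independent (range (\<lambda>k. axis k (a $ k)))"
  proof (rule pairwise_orthogonal_independent)
    show "pairwise orthogonal (range (\<lambda>k. axis k (a $ k)))"
      by (auto simp: pairwise_def orthogonal_def intro: orth)
    show "0 \<notin> range (\<lambda>k. axis k (a $ k))"
      using nz by force
  qed
  moreover have "snd (diag_config a) \<bullet> axis k (a $ k) = snd (diag_config a) $ k * a $ k" for k
    by (simp add: inner_axis)
  moreover have fst: "(\<lambda>k. fst (diag_config a) $ k) = (\<lambda>k. axis k (a $ k))"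
    by (simp add: diag_config_def)
  ultimately show ?thesis
    unfolding realizations_edges0_iff fst using diag_config_inner[OF assms] orth
    by (simp add: inner_axis_axis)
qed

text \<open>The normalized periods form an orthonormal frame \<open>u\<close>. The map
  \<open>R\<close> taking the standard basis to \<open>u\<close> carries the diagonal configuration
  to \<open>c\<close>, because inner products with the periods determine \<open>v\<close>.\<close>

lemma realization_congruent_diag_config:
  assumes c: "c \<in> realizations edges0 c0" and a_def: "a = (\<chi> k. norm (fst c $ k))"
  shows "a \<in> period_lengths" "congruence_class (diag_config a) = congruence_class c"
proof -
  define u where "u = (\<lambda>k. fst c $ k /\<^sub>R a $ k)"
  have orth: "fst c $ i \<bullet> fst c $ j = 0" if "i \<noteq> j" for i j
    using c that by (simp add: realizations_edges0_iff)
  have nz: "fst c $ k \<noteq> 0" for k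
    using c dependent_zero[of "range (\<lambda>k. fst c $ k)"] unfolding realizations_edges0_iff
    by (metis rangeI)
  have pos: "0 < a $ k" for k
    using nz by (simp add: a_def)
  have sq: "fst c $ k \<bullet> fst c $ k = a $ k * a $ k" for k
    by (simp add: a_def power2_norm_eq_inner[symmetric] power2_eq_square)
  have u: "u i \<bullet> u j = (if i = j then 1 else 0)" for i j
    using orth[of i j] pos[of i] by (cases "i = j") (simp_all add: u_def sq field_simps)
  have fst_c: "fst c $ k = a $ k *\<^sub>R u k" for k
    using pos[of k] by (simp add: u_def)
  define R where "R = (\<lambda>x::real^3. \<Sum>k\<in>UNIV. x $ k *\<^sub>R u k)"
  have R: "orthogonal_transformation R"
    unfolding orthogonal_transformation_def
  proof (intro conjI allI)
    show "linear R"
      by (rule linearI) (simp_all add: R_def scaleR_add_left sum.distrib scaleR_sum_right)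
    fix x y
    have "R x \<bullet> R y = x $ 1 * y $ 1 + x $ 2 * y $ 2 + x $ 3 * y $ 3"
      by (simp add: R_def sum_3 inner_simps u)
    then show "R x \<bullet> R y = x \<bullet> y"
      by (simp add: inner_vec_def sum_3)
  qed
  have R_axis: "R (axis k (a $ k)) = fst c $ k" for k
    by (simp add: R_def axis_def fst_c if_distrib[of "\<lambda>x. x *\<^sub>R _"] cong: if_cong)
  \<comment> \<open>These are the coordinates of \<open>v\<close> in the frame
    \<open>u\<close>.\<close>
  obtain y where y: "snd c = R y"
    using orthogonal_transformation_surj[OF R] by (metis surjD)
  have y_inner: "snd c \<bullet> fst c $ k = y $ k * a $ k" for k
    using R unfolding y R_axis[symmetric] orthogonal_transformation_def by (simp add: inner_axis)
  have eq: "2 * (y $ k * a $ k) = a $ k * a $ k - (if k = 3 then 2 else 0)" for k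
    using c unfolding realizations_edges0_iff y_inner sq by blast
  have y_eq: "y = (1/2) *\<^sub>R a - axis 3 (1 / a $ 3)"
    unfolding vec_eq_iff forall_3 using eq[of 1] eq[of 2] eq[of 3] pos[of 1] pos[of 2] pos[of 3]
    by (simp add: axis_def field_simps)
  have "y \<bullet> y = 3/4"
    using c R unfolding realizations_edges0_iff y orthogonal_transformation_def by simp
  moreover have "(a $ 3 / 2 - 1 / a $ 3)\<^sup>2 = (a $ 3)\<^sup>2 / 4 - 1 + 1 / (a $ 3)\<^sup>2"
    using pos[of 3] by (simp add: field_simps power2_eq_square)
  ultimately show "a \<in> period_lengths"
    using pos by (simp add: period_lengths_def y_eq inner_vec_def sum_3 axis_def
        power2_eq_square[symmetric] power_divide)
  have "c = ((\<chi> k. R (fst (diag_config a) $ k)), R (snd (diag_config a)))"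
    by (simp add: diag_config_def R_axis prod_eq_iff vec_eq_iff y y_eq)
  then show "congruence_class (diag_config a) = congruence_class c"
    using congruence_class_eqI[OF R] by metis
qed

section \<open>Infinitesimal deformations of diagonal configurations\<close>

text \<open>This is half the differential of the equation of \<open>period_lengths\<close>, at the
  diagonal entries of \<open>w\<close>. It follows from the linear constraints alone, without
  assuming that \<open>w\<close> is the velocity of a motion.\<close>

lemma infinitesimal_period_lengths:
  assumes a: "a \<in> period_lengths"
    and w: "w \<in> infinitesimal_deformations edges0 (diag_config a)"
  shows "a $ 1 * fst w $ 1 $ 1 + a $ 2 * fst w $ 2 $ 2 + (a $ 3 - 4 / (a $ 3) ^ 3) * fst w $ 3 $ 3 = 0"
proof -
  define v where "v = snd (diag_config a)"
  have pos: "a $ k \<noteq> 0" for k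
    using period_lengths_pos[OF a, of k] by simp
  have w1: "v \<bullet> snd w = 0"
    and w2: "v \<bullet> fst w $ k + a $ k * snd w $ k = a $ k * fst w $ k $ k"
    and w3: "i \<noteq> j \<Longrightarrow> a $ i * fst w $ j $ i + a $ j * fst w $ i $ j = 0" for i j k
    using w unfolding infinitesimal_deformations_edges0_iff
    by (simp_all add: diag_config_def v_def inner_axis' )
  have om: "snd w $ k = fst w $ k $ k - (v \<bullet> fst w $ k) / a $ k" for k
    using w2[of k] pos[of k] by (simp add: field_simps)
  have sym: "fst w $ j $ i / a $ j = - (fst w $ i $ j / a $ i)" if "i \<noteq> j" for i j
    using w3[OF that] pos[of i] pos[of j] by (simp add: field_simps)
  \<comment> \<open>With the velocity of \<open>v\<close> eliminated by \<open>om\<close>,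
    off-diagonal entries occur only in pairs that cancel by \<open>sym\<close>.\<close>
  have "0 = (\<Sum>k\<in>UNIV. v $ k * (fst w $ k $ k - (v \<bullet> fst w $ k) / a $ k))"
    using w1 by (simp add: inner_vec_def om)
  also have "\<dots> = (\<Sum>k\<in>UNIV. v $ k * (1 - v $ k / a $ k) * fst w $ k $ k)
      - v $ 1 * v $ 2 * (fst w $ 1 $ 2 / a $ 1 + fst w $ 2 $ 1 / a $ 2)
      - v $ 1 * v $ 3 * (fst w $ 1 $ 3 / a $ 1 + fst w $ 3 $ 1 / a $ 3)
      - v $ 2 * v $ 3 * (fst w $ 2 $ 3 / a $ 2 + fst w $ 3 $ 2 / a $ 3)"
    by (simp add: sum_3 inner_vec_def add_divide_distrib algebra_simps)
  also have "\<dots> = (\<Sum>k\<in>UNIV. v $ k * (1 - v $ k / a $ k) * fst w $ k $ k)"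
    using sym[of 2 1] sym[of 3 1] sym[of 3 2] by simp
  also have "\<dots> = (a $ 1 * fst w $ 1 $ 1 + a $ 2 * fst w $ 2 $ 2 +
      (a $ 3 - 4 / (a $ 3) ^ 3) * fst w $ 3 $ 3) / 4"
    using pos[of 1] pos[of 2] pos[of 3]
    by (simp add: v_def diag_config_def sum_3 axis_def field_simps power3_eq_cube)
  finally show ?thesis
    by simp
qed

lemma matrix_vector_mult_axis:
  fixes A :: "real^'n^'m"
  shows "(A *v axis k x) $ i = A $ i $ k * x"
  by (simp add: matrix_vector_mult_def axis_def if_distrib[of "\<lambda>x. _ * x"] cong: if_cong)

text \<open>The periods are axis-parallel, so column \<open>k\<close> of the only candidate matrix
  is the velocity of period \<open>k\<close> divided by \<open>a $ k\<close>. The orthogonality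
  constraints make it skew off the diagonal; vanishing diagonal entries do the rest.\<close>

lemma trivial_deformation_iff:
  assumes a: "a \<in> period_lengths"
    and w: "w \<in> infinitesimal_deformations edges0 (diag_config a)"
  shows "w \<in> trivial_deformations (diag_config a) \<longleftrightarrow> (\<forall>k. fst w $ k $ k = 0)"
proof
  assume "w \<in> trivial_deformations (diag_config a)"
  then obtain A :: "real^3^3" where A: "transpose A = - A" "fst w = (\<chi> k. A *v axis k (a $ k))"
    by (auto simp: trivial_deformations_def diag_config_def)
  have "A $ k $ k = - A $ k $ k" for k
    using arg_cong[OF A(1), of "\<lambda>B. B $ k $ k"] by (simp add: transpose_def)
  then have "A $ k $ k = 0" for k
    by (metis equal_neg_zero)
  then show "\<forall>k. fst w $ k $ k = 0"
    unfolding A(2) by (simp add: matrix_vector_mult_axis)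
next
  assume diag: "\<forall>k. fst w $ k $ k = 0"
  define v where "v = snd (diag_config a)"
  have pos: "a $ k \<noteq> 0" for k
    using period_lengths_pos[OF a, of k] by simp
  have w2: "v \<bullet> fst w $ k + a $ k * snd w $ k = 0"
    and w3: "i \<noteq> j \<Longrightarrow> a $ i * fst w $ j $ i + a $ j * fst w $ i $ j = 0" for i j k
    using w diag unfolding infinitesimal_deformations_edges0_iff
    by (simp_all add: diag_config_def v_def inner_axis')
  define A :: "real^3^3" where "A = (\<chi> i j. fst w $ j $ i / a $ j)"
  have skew: "A $ j $ i = - A $ i $ j" for i j
    using w3[of i j] pos[of i] pos[of j] diag by (cases "i = j") (simp_all add: A_def field_simps)
  have "A *v v = snd w"
  proof -
    have "(A *v v) $ i = snd w $ i" for i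
    proof -
      \<comment> \<open>Skewness turns row \<open>i\<close> into column \<open>i\<close>, the scaled
        velocity of period \<open>i\<close>, so that \<open>w2\<close> applies.\<close>
      have "(A *v v) $ i = (\<Sum>j\<in>UNIV. - A $ j $ i * v $ j)"
        unfolding matrix_vector_mult_def vec_lambda_beta
        by (intro sum.cong refl) (metis skew)
      also have "\<dots> = - (v \<bullet> fst w $ i) / a $ i"
        by (simp add: A_def inner_vec_def sum_negf sum_divide_distrib mult.commute)
      also have "\<dots> = snd w $ i"
        using w2[of i] pos[of i] by (simp add: field_simps)
      finally show ?thesis .
    qed
    then show ?thesis
      by (simp add: vec_eq_iff)
  qed
  moreover have "A *v axis k (a $ k) = fst w $ k" for k
    using pos by (simp add: vec_eq_iff matrix_vector_mult_axis A_def)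
  moreover have "transpose A = - A"
    by (simp add: transpose_def vec_eq_iff skew[symmetric])
  ultimately show "w \<in> trivial_deformations (diag_config a)"
    unfolding trivial_deformations_def
    by (auto simp: diag_config_def v_def prod_eq_iff vec_eq_iff intro!: exI[of _ A])
qed

subsection \<open>Charts\<close>

text \<open>With a variable set \<open>J\<close>, one chart construction covers both the full
  deformation space (\<open>J\<close> empty) and the mechanisms with one fixed period.\<close>

definition period_edges :: "3 set \<Rightarrow> edge set" where
  "period_edges J = (\<lambda>k. (Lattice 0, Lattice (axis k 1))) ` J"

lemma realizations_period_edges_iff:
  "c \<in> realizations (period_edges J \<union> edges0) c0 \<longleftrightarrow>
     c \<in> realizations edges0 c0 \<and> (\<forall>k\<in>J. norm (fst c $ k) = 1)"
proof -
  have "dist (position c (Lattice 0)) (position c (Lattice (axis k 1))) = norm (fst c $ k)" for c k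
    by simp
  then have "(\<forall>(x, y)\<in>period_edges J. dist (position c x) (position c y) =
      dist (position c0 x) (position c0 y)) \<longleftrightarrow> (\<forall>k\<in>J. norm (fst c $ k) = 1)"
    by (auto simp: period_edges_def c0_def simp del: position.simps)
  then show ?thesis
    unfolding realizations_def by blast
qed

lemma infinitesimal_deformations_period_edges_iff:
  "w \<in> infinitesimal_deformations (period_edges J \<union> edges0) c \<longleftrightarrow>
     w \<in> infinitesimal_deformations edges0 c \<and> (\<forall>k\<in>J. fst c $ k \<bullet> fst w $ k = 0)"
proof -
  have "edge_form c (Lattice 0, Lattice (axis k 1)) w = fst c $ k \<bullet> fst w $ k" for k
    by (simp add: edge_form_def)
  then show ?thesis
    by (auto simp: infinitesimal_deformations_def period_edges_def ball_Un)
qed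

text \<open>The only nonlinear ingredient is \<open>1 / a $ 3\<close>, which enters through a linear
  map.\<close>

lemma smooth_on_diag_config:
  assumes "open W" "smooth_on W A" "\<And>p. p \<in> W \<Longrightarrow> A p \<in> period_lengths"
  shows "smooth_on W (\<lambda>p. diag_config (A p))"
proof -
  define D :: "real^3 \<Rightarrow> config" where "D = (\<lambda>a. ((\<chi> k. axis k (a $ k)), (1/2) *\<^sub>R a))"
  define h :: "real \<Rightarrow> config" where "h = (\<lambda>x. (0, axis 3 (- x)))"
  have "linear D"
    by (rule linearI) (simp_all add: D_def vec_eq_iff axis_def scaleR_add_right)
  moreover have "linear h"
    by (rule linearI) (simp_all add: h_def vec_eq_iff axis_def)
  ultimately have "smooth_on W (\<lambda>p. D (A p) + h (inverse (A p $ 3)))"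
    using assms period_lengths_pos[of _ 3]
    by (intro smooth_on_add smooth_on_linear_compose[where h = D] smooth_on_linear_compose[where h = h]
        smooth_on_inverse smooth_on_linear_compose[OF _ bounded_linear_vec_nth])
      (auto simp: linear_conv_bounded_linear less_imp_neq[THEN not_sym])
  moreover have "D a + h (inverse (a $ 3)) = diag_config a" for a
    by (simp add: D_def h_def diag_config_def vec_eq_iff axis_def inverse_eq_divide)
  ultimately show ?thesis
    by simp
qed

text \<open>
  Here \<open>g\<close> selects the coordinates in which the surface \<open>period_lengths\<close>, cut down by
  the conditions \<open>a\<^sub>k = 1\<close> for \<open>k \<in> J\<close>, is parametrized by \<open>A\<close>; the last assumption is
  transversality at the infinitesimal level.
\<close>

lemma smooth_chart_diag_config:
  fixes A :: "'p::euclidean_space \<Rightarrow> real^3" and g :: "real^3 \<Rightarrow> 'p"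
  assumes W: "open W" "connected W" and A: "smooth_on W A"
    and g: "bounded_linear g"
    and A_lengths: "\<And>p. p \<in> W \<Longrightarrow> A p \<in> period_lengths"
    and A_J: "\<And>p k. p \<in> W \<Longrightarrow> k \<in> J \<Longrightarrow> A p $ k = 1"
    and g_A: "\<And>p. p \<in> W \<Longrightarrow> g (A p) = p"
    and one: "1 \<in> A ` W"
    and inj: "\<And>a b. a \<in> period_lengths \<Longrightarrow> b \<in> period_lengths \<Longrightarrow>
      \<forall>k\<in>J. a $ k = b $ k \<Longrightarrow> g a = g b \<Longrightarrow> a = b"
    and inf_inj: "\<And>a x. a \<in> period_lengths \<Longrightarrow>
      a $ 1 * x $ 1 + a $ 2 * x $ 2 + (a $ 3 - 4 / (a $ 3) ^ 3) * x $ 3 = 0 \<Longrightarrow>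
      \<forall>k\<in>J. x $ k = 0 \<Longrightarrow> g x = 0 \<Longrightarrow> x = 0"
  shows "smooth_chart_at (period_edges J \<union> edges0) c0 W (\<lambda>p. diag_config (A p))"
proof -
  let ?\<phi> = "\<lambda>p. diag_config (A p)" and ?E = "period_edges J \<union> edges0"
  let ?len = "\<lambda>c::config. \<chi> k. norm (fst c $ k)"
  have norm_diag: "norm (fst (diag_config a) $ k) = a $ k" if "a \<in> period_lengths" for a k
    using period_lengths_pos[OF that, of k] by (simp add: diag_config_def norm_eq_sqrt_inner inner_axis_axis)
  have len_diag: "?len (diag_config a) = a" if "a \<in> period_lengths" for a
    using norm_diag[OF that] by (simp add: vec_eq_iff)
  have smooth: "smooth_on W ?\<phi>"
    using smooth_on_diag_config[OF W(1) A A_lengths] .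
  have realize: "?\<phi> ` W \<subseteq> realizations ?E c0"
    using diag_config_realization[OF A_lengths] A_J norm_diag[OF A_lengths]
    by (auto simp: realizations_period_edges_iff)
  have c0_in: "c0 \<in> ?\<phi> ` W"
    using one by (metis c0_eq_diag_config image_eqI image_iff)
  have chart: "\<exists>V. openin (deformation_space ?E c0) V \<and>
    homeomorphic_map (top_of_set W) (subtopology (deformation_space ?E c0) V)
      (\<lambda>p. congruence_class (?\<phi> p))"
  proof (rule deformation_space_chart[where g = "\<lambda>c. g (?len c)"])
    show "continuous_on (realizations ?E c0) (\<lambda>c. g (?len c))"
      by (intro bounded_linear.continuous_on[OF g] continuous_intros)
    show "g (?len (?\<phi> p)) = p" if "p \<in> W" for p
      using g_A len_diag A_lengths that by simp
    show "congruence_class (?\<phi> (g (?len c))) = congruence_class c"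
      if c: "c \<in> realizations ?E c0" and W: "g (?len c) \<in> W" for c
    proof -
      have c': "c \<in> realizations edges0 c0" "\<forall>k\<in>J. norm (fst c $ k) = 1"
        using c by (simp_all add: realizations_period_edges_iff)
      note len = realization_congruent_diag_config[OF c'(1) refl]
      \<comment> \<open>Both sides lie on the surface and agree in the coordinates of
        \<open>J\<close> and under \<open>g\<close>.\<close>
      have "A (g (?len c)) = ?len c"
        using W c'(2) by (intro inj A_lengths len) (simp_all add: A_J g_A)
      with len show ?thesis
        by simp
    qed
    show "g (?len c') = g (?len c'')" if "congruence_class c' = congruence_class c''" for c' c''
      using congruence_class_eq_imp_norm_eq[OF that] by simp
  qed (use W smooth realize c0_in smooth_on_continuous_on in auto)
  have inf: "range (frechet_derivative ?\<phi> (at p)) \<subseteq> infinitesimal_deformations ?E (?\<phi> p) \<and>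
      (\<forall>w\<in>infinitesimal_deformations ?E (?\<phi> p).
         \<exists>!u. w - frechet_derivative ?\<phi> (at p) u \<in> trivial_deformations (?\<phi> p))"
    if p: "p \<in> W" for p
  proof (intro conjI ballI)
    define D where "D = frechet_derivative ?\<phi> (at p)"
    define \<alpha> :: "config \<Rightarrow> real^3" where "\<alpha> = (\<lambda>w. \<chi> k. fst w $ k $ k)"
    have D: "(?\<phi> has_derivative D) (at p)"
      unfolding D_def by (rule smooth_on_has_derivative[OF smooth p])
    have "linear \<alpha>"
      by (rule linearI) (simp_all add: \<alpha>_def vec_eq_iff)
    then have "bounded_linear (\<lambda>w. g (\<alpha> w))"
      using bounded_linear_compose[OF g] by (simp add: linear_conv_bounded_linear)
    then have "((\<lambda>p. g (\<alpha> (?\<phi> p))) has_derivative (\<lambda>u. g (\<alpha> (D u)))) (at p)"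
      using bounded_linear.has_derivative D by blast
    moreover have "\<alpha> (?\<phi> q) = A q" for q
      by (simp add: \<alpha>_def diag_config_def vec_eq_iff)
    ultimately have "((\<lambda>p. g (A p)) has_derivative (\<lambda>u. g (\<alpha> (D u)))) (at p)"
      by simp
    moreover have "((\<lambda>p. g (A p)) has_derivative (\<lambda>u. u)) (at p)"
      by (rule has_derivative_transform_within_open[OF has_derivative_ident W(1) p]) (simp add: g_A)
    \<comment> \<open>Differentiating \<open>g (A p) = p\<close> makes
      \<open>g \<circ> \<alpha>\<close> a left inverse of \<open>D\<close>.\<close>
    ultimately have g_D: "g (\<alpha> (D u)) = u" for u
      using has_derivative_unique fun_cong by metis
    show range_D: "range (frechet_derivative ?\<phi> (at p)) \<subseteq> infinitesimal_deformations ?E (?\<phi> p)"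
      using frechet_derivative_infinitesimal_deformations[OF W(1) p realize] D
      by (auto simp: differentiable_def)
    fix w assume w: "w \<in> infinitesimal_deformations ?E (?\<phi> p)"
    have diff: "w - D u \<in> infinitesimal_deformations ?E (?\<phi> p)" for u
    proof (rule subspace_diff[OF subspace_infinitesimal_deformations w])
      show "D u \<in> infinitesimal_deformations ?E (?\<phi> p)"
        using range_D unfolding D_def by blast
    qed
    have trivial_iff: "w - D u \<in> trivial_deformations (?\<phi> p) \<longleftrightarrow> \<alpha> (w - D u) = 0" for u
      using trivial_deformation_iff[OF A_lengths[OF p]] diff
      by (simp add: infinitesimal_deformations_period_edges_iff \<alpha>_def vec_eq_iff)
    have g_diff: "g (\<alpha> (w - D u)) = g (\<alpha> w) - u" for u
      using linear_diff[OF \<open>linear \<alpha>\<close>] linear_diff[OF bounded_linear.linear[OF g]] g_D by simp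
    show "\<exists>!u. w - frechet_derivative ?\<phi> (at p) u \<in> trivial_deformations (?\<phi> p)"
      unfolding D_def[symmetric] trivial_iff
    \<comment> \<open>Applying \<open>g\<close> to \<open>\<alpha> (w - D u) = 0\<close> forces
      \<open>u = g (\<alpha> w)\<close>. For this \<open>u\<close> the remainder satisfies the
      linearized surface equation and vanishes on \<open>J\<close> and under \<open>g\<close>, so
      \<open>inf_inj\<close> applies.\<close>
    proof (rule ex1I)
      let ?w = "w - D (g (\<alpha> w))"
      have "fst (?\<phi> p) $ k \<bullet> fst w' $ k = A p $ k * \<alpha> w' $ k" for k w'
        by (simp add: diag_config_def inner_axis' \<alpha>_def)
      moreover have "A p $ k \<noteq> 0" for k
        using period_lengths_pos[OF A_lengths[OF p], of k] by simp
      ultimately have "\<forall>k\<in>J. \<alpha> ?w $ k = 0"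
        using diff[of "g (\<alpha> w)"] unfolding infinitesimal_deformations_period_edges_iff
        by (metis mult_eq_0_iff)
      moreover have "A p $ 1 * \<alpha> ?w $ 1 + A p $ 2 * \<alpha> ?w $ 2 +
          (A p $ 3 - 4 / (A p $ 3) ^ 3) * \<alpha> ?w $ 3 = 0"
      proof -
        have "?w \<in> infinitesimal_deformations edges0 (?\<phi> p)"
          using diff by (simp only: infinitesimal_deformations_period_edges_iff)
        from infinitesimal_period_lengths[OF A_lengths[OF p] this] show ?thesis
          by (simp only: \<alpha>_def vec_lambda_beta)
      qed
      ultimately show "\<alpha> ?w = 0"
        using inf_inj[OF A_lengths[OF p]] g_diff by simp
      show "u = g (\<alpha> w)" if "\<alpha> (w - D u) = 0" for u
        using g_diff[of u] that linear_0[OF bounded_linear.linear[OF g]] by simp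
    qed
  qed
  show ?thesis
    unfolding smooth_chart_at_def
    using W(1) smooth realize c0_in chart inf by blast
qed

section \<open>Parametrizing the surface of period lengths\<close>

lemma smooth_on_vector_3:
  fixes f g h :: "'a::real_normed_vector \<Rightarrow> real"
  assumes "open S" "smooth_on S f" "smooth_on S g" "smooth_on S h"
  shows "smooth_on S (\<lambda>x. vector [f x, g x, h x] :: real^3)"
proof -
  have "smooth_on S (\<lambda>x. f x *\<^sub>R axis 1 1 + g x *\<^sub>R axis 2 1 + h x *\<^sub>R (axis 3 1 :: real^3))"
    by (intro smooth_on_add smooth_on_linear_compose[OF _ bounded_linear_scaleR_left] assms)
  moreover have "f x *\<^sub>R axis 1 1 + g x *\<^sub>R axis 2 1 + h x *\<^sub>R axis 3 1 =
      (vector [f x, g x, h x] :: real^3)" for x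
    by (simp add: vec_eq_iff forall_3 axis_def)
  ultimately show ?thesis
    by simp
qed

text \<open>
  Solves the equation of \<open>period_lengths\<close> for one of \<open>a\<^sub>1\<close>, \<open>a\<^sub>2\<close>, given the other one \<open>r\<close> and \<open>a\<^sub>3 = s\<close>.
\<close>

definition third_length :: "real \<Rightarrow> real \<Rightarrow> real" where
  "third_length r s = sqrt (7 - r\<^sup>2 - s\<^sup>2 - 4 * (inverse s)\<^sup>2)"

text \<open>
  Positivity of the radicand is multiplied by \<open>s\<^sup>2\<close>, so that the condition is polynomial and visibly open.
\<close>

definition admissible :: "real \<Rightarrow> real \<Rightarrow> bool" where
  "admissible r s \<longleftrightarrow> 0 < r \<and> 0 < s \<and> 4 < (7 - r\<^sup>2 - s\<^sup>2) * s\<^sup>2"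

lemma admissible_radicand_pos:
  "admissible r s \<Longrightarrow> 0 < 7 - r\<^sup>2 - s\<^sup>2 - 4 * (inverse s)\<^sup>2"
  by (simp add: admissible_def power_inverse field_simps)

lemma smooth_on_third_length:
  assumes "open S" "smooth_on S f" "smooth_on S g" "\<And>x. x \<in> S \<Longrightarrow> admissible (f x) (g x)"
  shows "smooth_on S (\<lambda>x. third_length (f x) (g x))"
proof -
  have "g x \<noteq> 0" if "x \<in> S" for x
    using assms(4)[OF that] by (simp add: admissible_def)
  then show ?thesis
    unfolding third_length_def
    using assms admissible_radicand_pos
    by (intro smooth_on_sqrt smooth_on_diff smooth_on_mult smooth_on_power2 smooth_on_inverse
        smooth_on_const) auto
qed

lemma third_length_1_1: "third_length 1 1 = 1"
  by (simp add: third_length_def)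

lemma admissible_period_lengths:
  assumes "admissible r s"
  shows "vector [r, third_length r s, s] \<in> period_lengths"
    and "vector [third_length r s, r, s] \<in> period_lengths"
proof -
  have "(third_length r s)\<^sup>2 = 7 - r\<^sup>2 - s\<^sup>2 - 4 / s\<^sup>2" "0 < third_length r s"
    using admissible_radicand_pos[OF assms]
    by (simp_all add: third_length_def power_inverse divide_inverse)
  then show "vector [r, third_length r s, s] \<in> period_lengths"
    and "vector [third_length r s, r, s] \<in> period_lengths"
    using assms by (simp_all add: period_lengths_def forall_3 admissible_def)
qed

text \<open>The equation fixes the square of the remaining length, and positivity selects the
  root.\<close>

lemma period_lengths_eqI:
  assumes "a \<in> period_lengths" "b \<in> period_lengths"
    and "a $ i = b $ i" "a $ 3 = b $ 3" "i = 1 \<or> i = 2"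
  shows "a = b"
proof -
  have "(a $ 1)\<^sup>2 + (a $ 2)\<^sup>2 = (b $ 1)\<^sup>2 + (b $ 2)\<^sup>2"
    using assms by (simp add: period_lengths_def)
  moreover have "0 \<le> a $ k" "0 \<le> b $ k" for k
    using assms(1,2) period_lengths_pos less_imp_le by blast+
  ultimately show ?thesis
    using assms(3-5) by (auto simp: vec_eq_iff forall_3 power2_eq_iff_nonneg)
qed

text \<open>The coordinates are \<open>a $ 1\<close> and \<open>a $ 3\<close>: solving for the
  second length takes only a square root, and the coefficient \<open>a $ 2\<close> of its velocity
  is nonzero.\<close>

lemma smooth_chart_edges0:
  "\<exists>(W :: (real^2) set) \<phi>. smooth_chart_at edges0 c0 W \<phi>"
proof -
  define U where "U = {p::real^2. admissible (p $ 1) (p $ 2)}"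
  have "open U"
    unfolding U_def admissible_def
    by (intro open_Collect_conj open_Collect_less continuous_intros)
  moreover have "1 \<in> U"
    by (simp add: U_def admissible_def)
  ultimately obtain e where e: "0 < e" "ball 1 e \<subseteq> U"
    using openE by blast
  let ?W = "ball (1::real^2) e"
  define A :: "real^2 \<Rightarrow> real^3" where "A = (\<lambda>p. vector [p $ 1, third_length (p $ 1) (p $ 2), p $ 2])"
  define g :: "real^3 \<Rightarrow> real^2" where "g = (\<lambda>a. vector [a $ 1, a $ 3])"
  have adm: "admissible (p $ 1) (p $ 2)" if "p \<in> ?W" for p
    using e(2) that by (auto simp: U_def)
  have "smooth_chart_at (period_edges {} \<union> edges0) c0 ?W (\<lambda>p. diag_config (A p))"
  proof (rule smooth_chart_diag_config[where g = g])
    show "smooth_on ?W A"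
      unfolding A_def using adm
      by (intro smooth_on_vector_3 smooth_on_third_length smooth_on_linear bounded_linear_vec_nth) auto
    have "linear g"
      by (rule linearI) (simp_all add: g_def vec_eq_iff forall_2)
    then show "bounded_linear g"
      by (simp add: linear_conv_bounded_linear)
    show "A p \<in> period_lengths" if "p \<in> ?W" for p
      unfolding A_def by (rule admissible_period_lengths(1)[OF adm[OF that]])
    show "g (A p) = p" for p
      by (simp add: g_def A_def vec_eq_iff forall_2)
    have "A 1 = 1"
      by (simp add: A_def vec_eq_iff forall_3 third_length_1_1)
    then show "1 \<in> A ` ?W"
      using e(1) by (metis centre_in_ball image_eqI)
    show "a = b" if "a \<in> period_lengths" "b \<in> period_lengths" "g a = g b" for a b
      using that by (intro period_lengths_eqI[where i = 1]) (simp_all add: g_def vec_eq_iff forall_2)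
    show "x = 0" if "a \<in> period_lengths" "g x = 0"
      "a $ 1 * x $ 1 + a $ 2 * x $ 2 + (a $ 3 - 4 / (a $ 3) ^ 3) * x $ 3 = 0" for a x
      using that period_lengths_pos[OF that(1), of 2]
      by (simp add: g_def vec_eq_iff forall_2 forall_3)
  qed auto
  then show ?thesis
    by (auto simp: period_edges_def)
qed

lemma admissible_near_1:
  assumes "\<bar>s - 1\<bar> < 1/10"
  shows "admissible 1 s"
proof -
  have s: "9/10 < s" "s < 11/10"
    using assms by linarith+
  have "(9/10)\<^sup>2 < s\<^sup>2" "s\<^sup>2 < (11/10)\<^sup>2"
    using s by (intro power_strict_mono; simp)+
  then have x: "81/100 < s\<^sup>2" "s\<^sup>2 < 121/100"
    by (simp_all add: power2_eq_square)
  \<comment> \<open>In \<open>x = s^2\<close> the claim reads \<open>x^2 - 6 x + 4 < 0\<close>; this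
    product bounds \<open>x^2\<close> by a linear expression, which makes the rest linear.\<close>
  have "0 < (s\<^sup>2 - 81/100) * (121/100 - s\<^sup>2)"
    using x by simp
  then have "4 < (6 - s\<^sup>2) * s\<^sup>2"
    using x by (simp add: algebra_simps)
  then show ?thesis
    using s by (simp add: admissible_def)
qed

text \<open>With one of the first two lengths kept at 1, the surface is cut down to a curve with
  coordinate \<open>a $ 3\<close>.\<close>

lemma smooth_chart_fixed_period:
  assumes i: "i = 1 \<or> i = 2"
  shows "\<exists>(W :: real set) \<phi>. smooth_chart_at (insert (Lattice 0, Lattice (axis i 1)) edges0) c0 W \<phi>"
proof -
  let ?W = "ball (1::real) (1/10)"
  define A :: "real \<Rightarrow> real^3" where
    "A = (\<lambda>s. if i = 1 then vector [1, third_length 1 s, s] else vector [third_length 1 s, 1, s])"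
  have adm: "admissible 1 s" if "s \<in> ?W" for s
    using that by (intro admissible_near_1) (simp add: dist_norm abs_minus_commute)
  have "smooth_chart_at (period_edges {i} \<union> edges0) c0 ?W (\<lambda>p. diag_config (A p))"
  proof (rule smooth_chart_diag_config[where g = "\<lambda>a. a $ 3"])
    have "smooth_on ?W (third_length 1)"
      using adm by (intro smooth_on_third_length smooth_on_const smooth_on_linear bounded_linear_ident) auto
    then show "smooth_on ?W A"
      unfolding A_def
      by (cases "i = 1") (simp_all add: smooth_on_vector_3 smooth_on_const smooth_on_linear)
    show "A p \<in> period_lengths" if "p \<in> ?W" for p
      using admissible_period_lengths[OF adm[OF that]] by (simp add: A_def)
    show "A p $ k = 1" if "k \<in> {i}" for p k
      using that i by (auto simp: A_def)
    show "A p $ 3 = p" for p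
      by (simp add: A_def)
    have "A 1 = 1"
      by (simp add: A_def vec_eq_iff forall_3 third_length_1_1)
    then show "1 \<in> A ` ?W"
      by (metis centre_in_ball image_eqI zero_less_divide_1_iff zero_less_numeral)
    show "a = b" if "a \<in> period_lengths" "b \<in> period_lengths" "\<forall>k\<in>{i}. a $ k = b $ k" "a $ 3 = b $ 3" for a b
      using that i by (intro period_lengths_eqI[where i = i]) auto
    show "x = 0" if "a \<in> period_lengths" "\<forall>k\<in>{i}. x $ k = 0" "x $ 3 = 0"
      "a $ 1 * x $ 1 + a $ 2 * x $ 2 + (a $ 3 - 4 / (a $ 3) ^ 3) * x $ 3 = 0" for a x
      using that period_lengths_pos[OF that(1), of 1] period_lengths_pos[OF that(1), of 2] i
      by (auto simp: vec_eq_iff forall_3)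
  qed (auto intro: bounded_linear_vec_nth)
  then show ?thesis
    by (auto simp: period_edges_def)
qed

section \<open>An expansive motion\<close>

text \<open>With \<open>x = s^2\<close> the radicand is a constant minus \<open>x + 4/x\<close>, and
  \<open>x + 4/x\<close> decreases for \<open>0 < x \<le> 2\<close>.\<close>

lemma third_length_mono:
  assumes "0 < s" "s \<le> t" "t\<^sup>2 \<le> 2"
  shows "third_length r s \<le> third_length r t"
proof -
  define x y where "x = s\<^sup>2" and "y = t\<^sup>2"
  have xy: "0 < x" "x \<le> y" "y \<le> 2"
    using assms by (auto simp: x_def y_def power_mono)
  have "0 \<le> (y - x) * (4 - x * y)"
    using xy mult_mono[of x 2 y 2] by (intro mult_nonneg_nonneg) auto
  then have "y + 4 * inverse y \<le> x + 4 * inverse x"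
    using xy by (simp add: field_simps)
  then show ?thesis
    unfolding third_length_def by (simp add: x_def y_def power_inverse)
qed

text \<open>The first period keeps its length while the third grows. By
  \<open>third_length_mono\<close> the second grows too, so the nonnegative coefficients of
  \<open>distance_coefficients\<close> make all distances monotone.\<close>

lemma expansive_capabilities_edges0: "expansive_capabilities edges0 c0"
proof -
  let ?I = "{- (1/10)<..<(1/10::real)}"
  define a :: "real \<Rightarrow> real^3" where "a = (\<lambda>t. vector [1, third_length 1 (1 + t), 1 + t])"
  define \<gamma> where "\<gamma> = (\<lambda>t. diag_config (a t))"
  have adm: "admissible 1 (1 + t)" if "t \<in> ?I" for t
    using that by (intro admissible_near_1) auto
  have lengths: "a t \<in> period_lengths" if "t \<in> ?I" for t
    unfolding a_def by (rule admissible_period_lengths(1)[OF adm[OF that]])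
  have norm: "norm (fst (\<gamma> t) $ k) = a t $ k" if "t \<in> ?I" for t k
    using period_lengths_pos[OF lengths[OF that], of k]
    by (simp add: \<gamma>_def diag_config_def norm_eq_sqrt_inner inner_axis_axis)
  have realize: "\<gamma> t \<in> realizations edges0 c0" if "t \<in> ?I" for t
    unfolding \<gamma>_def by (rule diag_config_realization[OF lengths[OF that]])
  have linear: "smooth_on ?I (\<lambda>t. 1 + t)"
    by (intro smooth_on_add smooth_on_const smooth_on_linear bounded_linear_ident) auto
  have "smooth_on ?I a"
    unfolding a_def using adm
    by (intro smooth_on_vector_3 smooth_on_third_length smooth_on_const linear) auto
  then have smooth: "smooth_on ?I \<gamma>"
    unfolding \<gamma>_def using lengths by (intro smooth_on_diag_config) auto
  have "a 0 = 1"
    by (simp add: a_def vec_eq_iff forall_3 third_length_1_1)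
  then have start: "\<gamma> 0 = c0"
    by (simp add: \<gamma>_def c0_eq_diag_config)
  have mono: "mono_on ?I (\<lambda>t. dist (position (\<gamma> t) x) (position (\<gamma> t) y))" for x y
  proof (rule mono_onI)
    fix r t assume rt: "r \<in> ?I" "t \<in> ?I" "r \<le> t"
    \<comment> \<open>Since \<open>(11/10)^2 < 2\<close>, the whole interval lies in the range of
      \<open>third_length_mono\<close>.\<close>
    have "(1 + t)\<^sup>2 \<le> (11/10)\<^sup>2"
      using rt by (intro power_mono) auto
    then have "third_length 1 (1 + r) \<le> third_length 1 (1 + t)"
      using rt by (intro third_length_mono) (auto simp: power2_eq_square)
    then have "a r $ k \<le> a t $ k" for k
      using rt(3) exhaust_3[of k] by (auto simp: a_def)
    then have sq: "(a r $ k)\<^sup>2 \<le> (a t $ k)\<^sup>2" for k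
      using period_lengths_pos[OF lengths[OF rt(1)], of k] by (simp add: power_mono)
    obtain q :: "3 \<Rightarrow> real" and K where q: "\<And>k. 0 \<le> q k"
      "\<And>c. c \<in> realizations edges0 c0 \<Longrightarrow>
        (dist (position c x) (position c y))\<^sup>2 = K + (\<Sum>k\<in>UNIV. q k * (norm (fst c $ k))\<^sup>2)"
      by (rule distance_coefficients) (rule that)
    have "(dist (position (\<gamma> r) x) (position (\<gamma> r) y))\<^sup>2 \<le> (dist (position (\<gamma> t) x) (position (\<gamma> t) y))\<^sup>2"
      unfolding q(2)[OF realize[OF rt(1)]] q(2)[OF realize[OF rt(2)]] norm[OF rt(1)] norm[OF rt(2)]
      using q(1) sq by (intro add_left_mono sum_mono mult_left_mono) auto
    then show "dist (position (\<gamma> r) x) (position (\<gamma> r) y) \<le> dist (position (\<gamma> t) x) (position (\<gamma> t) y)"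
      by (rule power2_le_imp_le) simp
  qed
  have "norm (fst (\<gamma> (1/20)) $ 3) \<noteq> norm (fst c0 $ 3)"
    by (simp add: norm) (simp add: a_def c0_def)
  then have "\<gamma> (1/20) \<notin> congruence_class c0"
    using congruence_class_norm by blast
  then have "\<exists>t\<in>{0<..<1/10}. \<gamma> t \<notin> congruence_class c0"
    by (intro bexI[of _ "1/20"]) auto
  with smooth start realize mono show ?thesis
    unfolding expansive_capabilities_def
    by (intro exI[of _ "1/10"] conjI exI[of _ \<gamma>]) auto
qed

subsection \<open>The expansive cone\<close>

lemma fst_c0_inner: "fst c0 $ k \<bullet> x = x $ k"
  by (simp add: c0_def inner_axis')

text \<open>At \<open>a = 1\<close> the coefficient of the third entry in the linearized equation is
  \<open>1 - 4 = -3\<close>.\<close>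

lemma infinitesimal_deformations_c0_third:
  assumes "w \<in> infinitesimal_deformations edges0 c0"
  shows "fst w $ 3 $ 3 = (fst w $ 1 $ 1 + fst w $ 2 $ 2) / 3"
  using infinitesimal_period_lengths[OF one_in_period_lengths assms[unfolded c0_eq_diag_config]]
  by simp

lemma trivial_deformations_c0_iff:
  assumes "w \<in> infinitesimal_deformations edges0 c0"
  shows "w \<in> trivial_deformations c0 \<longleftrightarrow> fst w $ 1 $ 1 = 0 \<and> fst w $ 2 $ 2 = 0"
  using trivial_deformation_iff[OF one_in_period_lengths assms[unfolded c0_eq_diag_config]]
    infinitesimal_deformations_c0_third[OF assms]
  by (auto simp: c0_eq_diag_config[symmetric] forall_3)

text \<open>Distances from the origin to the ends of the periods give necessity. For sufficiency,
  the third diagonal entry is a positive combination of the first two, and the distance coefficients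
  are nonnegative.\<close>

lemma expansive_cone_c0_iff:
  "w \<in> expansive_cone edges0 c0 \<longleftrightarrow>
     w \<in> infinitesimal_deformations edges0 c0 \<and> 0 \<le> fst w $ 1 $ 1 \<and> 0 \<le> fst w $ 2 $ 2"
proof -
  have form: "frechet_derivative (\<lambda>c'. (dist (position c' x) (position c' y))\<^sup>2) (at c0) w =
      2 * edge_form c0 (x, y) w" for x y
    using frechet_derivative_at[OF has_derivative_dist_position[OF has_derivative_ident]]
    by (metis (no_types))
  have "(\<forall>x y. 0 \<le> edge_form c0 (x, y) w) \<longleftrightarrow> 0 \<le> fst w $ 1 $ 1 \<and> 0 \<le> fst w $ 2 $ 2"
    if w: "w \<in> infinitesimal_deformations edges0 c0"
  proof (intro iffI allI)
    assume "\<forall>x y. 0 \<le> edge_form c0 (x, y) w"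
    then have "0 \<le> edge_form c0 (Lattice 0, Lattice (axis k 1)) w" for k
      by blast
    then show "0 \<le> fst w $ 1 $ 1 \<and> 0 \<le> fst w $ 2 $ 2"
      by (simp add: edge_form_def fst_c0_inner)
  next
    fix x y
    assume nonneg: "0 \<le> fst w $ 1 $ 1 \<and> 0 \<le> fst w $ 2 $ 2"
    obtain q :: "3 \<Rightarrow> real" where q: "\<And>k. 0 \<le> q k"
      "\<And>c w. w \<in> infinitesimal_deformations edges0 c \<Longrightarrow>
        edge_form c (x, y) w = (\<Sum>k\<in>UNIV. q k * (fst c $ k \<bullet> fst w $ k))"
      by (rule distance_coefficients) (rule that)
    have "0 \<le> fst w $ k $ k" for k
      using exhaust_3[of k] nonneg infinitesimal_deformations_c0_third[OF w] by auto
    then show "0 \<le> edge_form c0 (x, y) w"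
      unfolding q(2)[OF w] fst_c0_inner using q(1) by (simp add: sum_nonneg)
  qed
  then show ?thesis
    by (auto simp: expansive_cone_def form)
qed

text \<open>
  The infinitesimal deformation with \<open>\<lambda>\<^sub>1' = x e\<^sub>1\<close>, \<open>\<lambda>\<^sub>2' = y e\<^sub>2\<close> and \<open>\<lambda>\<^sub>3'\<close> along \<open>e\<^sub>3\<close>; its other components are forced.
\<close>

definition stretch :: "real \<Rightarrow> real \<Rightarrow> config" where
  "stretch x y =
     ((\<chi> k. axis k (vector [x, y, (x + y) / 3] $ k)), vector [x / 2, y / 2, (x + y) / 2])"

lemma stretch_infinitesimal_deformation: "stretch x y \<in> infinitesimal_deformations edges0 c0"
proof -
  have "snd c0 \<bullet> snd (stretch x y) = 0"
    by (simp add: c0_def stretch_def inner_vec_def sum_3 axis_def field_simps)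
  moreover have "\<forall>i. snd c0 \<bullet> fst (stretch x y) $ i + fst c0 $ i \<bullet> snd (stretch x y) =
      fst c0 $ i \<bullet> fst (stretch x y) $ i"
    unfolding forall_3 by (simp add: fst_c0_inner stretch_def inner_axis) (simp add: c0_def axis_def field_simps)
  moreover have "fst c0 $ i \<bullet> fst (stretch x y) $ j = 0" if "i \<noteq> j" for i j
    using that by (simp add: fst_c0_inner stretch_def axis_def)
  ultimately show ?thesis
    by (simp add: infinitesimal_deformations_edges0_iff)
qed

lemma stretch_diagonal [simp]: "fst (stretch x y) $ 1 $ 1 = x" "fst (stretch x y) $ 2 $ 2 = y"
  by (simp_all add: stretch_def)

section \<open>Faces and extremal rays of the cone\<close>

text \<open>At \<open>c0\<close> the period \<open>i\<close> is a standard basis vector, so the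
  diagonal entry is its inner product with its velocity.\<close>

definition fixed_period_face :: "3 \<Rightarrow> config set" where
  "fixed_period_face i = {w \<in> expansive_cone edges0 c0. fst w $ i $ i = 0}"

text \<open>Modulo trivial deformations only the \<open>j\<close>-th diagonal entry is free on this
  face. Any nontrivial element generates the ray, so the lemma also serves to identify a given
  extremal ray.\<close>

lemma fixed_period_face_eq_ray:
  assumes ij: "{i, j} = {1, 2::3}" and w: "w \<in> fixed_period_face i" "w \<notin> trivial_deformations c0"
  shows "fixed_period_face i = {t *\<^sub>R w + y |t y. 0 \<le> t \<and> y \<in> trivial_deformations c0}"
proof -
  let ?I = "infinitesimal_deformations edges0 c0"
  have cone: "x \<in> expansive_cone edges0 c0 \<longleftrightarrow> x \<in> ?I \<and> 0 \<le> fst x $ i $ i \<and> 0 \<le> fst x $ j $ j" for x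
    using ij unfolding expansive_cone_c0_iff doubleton_eq_iff by auto
  have trivial: "x \<in> trivial_deformations c0 \<longleftrightarrow> fst x $ i $ i = 0 \<and> fst x $ j $ j = 0" if "x \<in> ?I" for x
    using ij unfolding trivial_deformations_c0_iff[OF that] doubleton_eq_iff by auto
  have wI: "w \<in> ?I" and wi: "fst w $ i $ i = 0" and wj: "0 < fst w $ j $ j"
    using w trivial[of w] by (auto simp: fixed_period_face_def cone less_le)
  note sub = subspace_infinitesimal_deformations[of edges0 c0]
  show ?thesis
  proof (intro equalityI subsetI)
    fix x assume x: "x \<in> fixed_period_face i"
    define t where "t = fst x $ j $ j / fst w $ j $ j"
    have "x \<in> ?I"
      using x by (simp add: fixed_period_face_def cone)
    then have "x - t *\<^sub>R w \<in> ?I"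
      using wI sub by (simp add: subspace_diff subspace_scale)
    then have "x - t *\<^sub>R w \<in> trivial_deformations c0"
      using x wi wj by (simp add: trivial fixed_period_face_def t_def)
    moreover have "0 \<le> t"
      using x wj by (simp add: t_def fixed_period_face_def cone)
    moreover have "x = t *\<^sub>R w + (x - t *\<^sub>R w)"
      by simp
    ultimately show "x \<in> {t *\<^sub>R w + y |t y. 0 \<le> t \<and> y \<in> trivial_deformations c0}"
      by blast
  next
    fix x assume "x \<in> {t *\<^sub>R w + y |t y. 0 \<le> t \<and> y \<in> trivial_deformations c0}"
    then obtain t y where t: "x = t *\<^sub>R w + y" "0 \<le> t" "y \<in> trivial_deformations c0"
      by blast
    have y: "y \<in> ?I"
      using t(3) trivial_deformations_subset by blast
    then have "x \<in> ?I"
      unfolding t(1) using wI sub by (simp add: subspace_add subspace_scale)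
    then show "x \<in> fixed_period_face i"
      using t(2,3) trivial[OF y] wi wj by (simp add: fixed_period_face_def cone t(1))
  qed
qed

lemma face_fixed_period_face:
  assumes "i = 1 \<or> i = 2"
  shows "fixed_period_face i face_of expansive_cone edges0 c0"
proof -
  \<comment> \<open>Writing diagonal entries as inner products exhibits the faces as intersections
    with supporting hyperplanes.\<close>
  define h :: "3 \<Rightarrow> config" where "h = (\<lambda>k. (axis k (axis k 1), 0))"
  have h: "h k \<bullet> w = fst w $ k $ k" for k w
    by (simp add: h_def inner_prod_def inner_axis')
  have "expansive_cone edges0 c0 =
      infinitesimal_deformations edges0 c0 \<inter> {w. 0 \<le> h 1 \<bullet> w} \<inter> {w. 0 \<le> h 2 \<bullet> w}"
    by (auto simp: expansive_cone_c0_iff h)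
  moreover have "convex \<dots>"
    by (intro convex_Int subspace_imp_convex subspace_infinitesimal_deformations convex_halfspace_ge)
  ultimately have "convex (expansive_cone edges0 c0)"
    by simp
  then have "expansive_cone edges0 c0 \<inter> {w. h i \<bullet> w = 0} face_of expansive_cone edges0 c0"
    using assms by (intro face_of_Int_supporting_hyperplane_ge) (auto simp: expansive_cone_c0_iff h)
  moreover have "expansive_cone edges0 c0 \<inter> {w. h i \<bullet> w = 0} = fixed_period_face i"
    by (auto simp: fixed_period_face_def h)
  ultimately show ?thesis
    by simp
qed

text \<open>Modulo trivial deformations the cone is a quadrant with these faces as boundary rays. A
  generator inside the quadrant would be the midpoint of two nonproportional elements of the
  cone.\<close>

lemma extremal_ray_iff:
  "extremal_ray edges0 c0 F \<longleftrightarrow> F = fixed_period_face 1 \<or> F = fixed_period_face 2"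
proof -
  have ij: "{1, 2} = {1, 2::3}" "{2, 1} = {1, 2::3}"
    by auto
  have stretch: "stretch 0 1 \<in> fixed_period_face 1" "stretch 1 0 \<in> fixed_period_face 2"
    "stretch 0 1 \<notin> trivial_deformations c0" "stretch 1 0 \<notin> trivial_deformations c0"
    by (simp_all add: fixed_period_face_def expansive_cone_c0_iff stretch_infinitesimal_deformation
        trivial_deformations_c0_iff)
  have "extremal_ray edges0 c0 (fixed_period_face 1)" "extremal_ray edges0 c0 (fixed_period_face 2)"
    unfolding extremal_ray_def
    using face_fixed_period_face[of 1] face_fixed_period_face[of 2] stretch
      fixed_period_face_eq_ray[OF ij(1) stretch(1)] fixed_period_face_eq_ray[OF ij(2) stretch(2)]
    by blast+
  moreover have "F = fixed_period_face 1 \<or> F = fixed_period_face 2" if "extremal_ray edges0 c0 F"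
  proof -
    obtain w where face: "F face_of expansive_cone edges0 c0" and w: "w \<notin> trivial_deformations c0"
      and F: "F = {t *\<^sub>R w + y |t y. 0 \<le> t \<and> y \<in> trivial_deformations c0}"
      using \<open>extremal_ray edges0 c0 F\<close> unfolding extremal_ray_def by blast
    note sub = subspace_infinitesimal_deformations[of edges0 c0]
    have "0 \<in> trivial_deformations c0"
      using trivial_deformations_c0_iff[OF subspace_0[OF sub]] by simp
    then have wF: "w \<in> F"
      unfolding F by (intro CollectI exI[of _ 1] exI[of _ 0]) simp
    then have w_cone: "w \<in> expansive_cone edges0 c0"
      using face face_of_imp_subset by blast
    have "fst w $ 1 $ 1 = 0 \<or> fst w $ 2 $ 2 = 0"
    proof (rule ccontr)
      assume "\<not> (fst w $ 1 $ 1 = 0 \<or> fst w $ 2 $ 2 = 0)"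
      then have pos: "0 < fst w $ 1 $ 1" "0 < fst w $ 2 $ 2"
        using w_cone by (auto simp: expansive_cone_c0_iff less_le)
      \<comment> \<open>Chosen so that \<open>w + d\<close> has second diagonal entry 0 and
        \<open>w - d\<close> has first diagonal entry 0, one on each boundary ray.\<close>
      define d where "d = stretch (fst w $ 1 $ 1) (- (fst w $ 2 $ 2))"
      have d_diag: "fst d $ 1 $ 1 = fst w $ 1 $ 1" "fst d $ 2 $ 2 = - (fst w $ 2 $ 2)"
        by (simp_all add: d_def)
      have dI: "d \<in> infinitesimal_deformations edges0 c0"
        unfolding d_def by (rule stretch_infinitesimal_deformation)
      have ends: "w - d \<in> expansive_cone edges0 c0" "w + d \<in> expansive_cone edges0 c0"
        using w_cone pos sub dI
        by (simp_all add: expansive_cone_c0_iff subspace_diff subspace_add d_diag)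
      have "d \<noteq> 0"
        using d_diag(1) pos(1) by auto
      then have "w - d \<noteq> w + d"
        by (simp add: diff_eq_eq add.assoc scaleR_2[symmetric])
      moreover have "midpoint (w - d) (w + d) = w"
        by (simp add: midpoint_def scaleR_2[symmetric])
      ultimately have "w \<in> open_segment (w - d) (w + d)"
        using midpoint_in_open_segment by metis
      then have "w + d \<in> F"
        using face ends wF unfolding face_of_def by blast
      then obtain t y where t: "w + d = t *\<^sub>R w + y" "y \<in> trivial_deformations c0"
        unfolding F by blast
      have y: "fst y $ 1 $ 1 = 0" "fst y $ 2 $ 2 = 0"
        using t(2) trivial_deformations_subset[of c0 edges0] trivial_deformations_c0_iff by blast+
      have "fst (w + d) $ k $ k = t * fst w $ k $ k + fst y $ k $ k" for k
        unfolding t(1) by simp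
      \<comment> \<open>The first entry demands \<open>t = 2\<close>, the second
        \<open>t = 0\<close>.\<close>
      from this[of 1] this[of 2] show False
        using pos by (simp add: d_diag y)
    qed
    then have "w \<in> fixed_period_face 1 \<or> w \<in> fixed_period_face 2"
      using w_cone by (simp add: fixed_period_face_def)
    then show ?thesis
      using fixed_period_face_eq_ray[OF ij(1) _ w] fixed_period_face_eq_ray[OF ij(2) _ w] F by blast
  qed
  ultimately show ?thesis
    by blast
qed

lemma fixes_period_length_edges0:
  assumes "i = 1 \<or> i = 2"
  shows "fixes_period_length edges0 c0 i (fixed_period_face i)"
  using smooth_chart_fixed_period[OF assms]
  by (simp add: fixes_period_length_def fixed_period_face_def fst_c0_inner)

theorem theorem7:
  shows "stressed edges0 c0 \<and>
    (\<exists>(W :: (real^2) set) \<phi>. smooth_chart_at edges0 c0 W \<phi>) \<and>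
    expansive_capabilities edges0 c0 \<and>
    (\<exists>F\<^sub>1 F\<^sub>2. F\<^sub>1 \<noteq> F\<^sub>2 \<and> {F. extremal_ray edges0 c0 F} = {F\<^sub>1, F\<^sub>2} \<and>
       fixes_period_length edges0 c0 1 F\<^sub>1 \<and> fixes_period_length edges0 c0 2 F\<^sub>2)"
proof (intro conjI stressed_edges0 smooth_chart_edges0 expansive_capabilities_edges0 exI)
  have "stretch 0 1 \<in> fixed_period_face 1" "stretch 0 1 \<notin> fixed_period_face 2"
    by (simp_all add: fixed_period_face_def expansive_cone_c0_iff stretch_infinitesimal_deformation)
  then show "fixed_period_face 1 \<noteq> fixed_period_face 2"
    by blast
  show "{F. extremal_ray edges0 c0 F} = {fixed_period_face 1, fixed_period_face 2}"
    by (auto simp: extremal_ray_iff)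
  show "fixes_period_length edges0 c0 1 (fixed_period_face 1)"
    and "fixes_period_length edges0 c0 2 (fixed_period_face 2)"
    by (simp_all add: fixes_period_length_edges0)
qed

end
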